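(* There is an absolute constant $c>0$ such that every set $P$ of $n$ points in general position in the plane has at least $c\,\frac{n^2}{L(P)}-c^{-1}$ $5$-holes. Moreover, if $\ell_1$ denotes the first layer of $P$, then $P$ also has at least $c\,|\ell_1|\cdot n-c^{-1}$ $5$-holes.
   Context: A finite point set is in general position if no three of its points are collinear. A $5$-hole of $P$ is a convex pentagon with vertices in $P$ containing no point of $P$ in its interior. The layer decomposition of $P$: the first layer $\ell_1$ is the set of points of $P$ lying on the boundary of the convex hull of $P$; inductively, $\ell_{k+1}$ is the first layer of $P\setminus(\ell_1\cup\dots\cup\ell_k)$, and the process stops once $P=\ell_1\cup\dots\cup\ell_k$. $L(P)$ is the number of layers. *)

theory Defs
  imports "HOL-Analysis.Analysis"
begin

definition general_position :: "(real ^ 2) set \<Rightarrow> bool" where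
  "general_position P \<longleftrightarrow> (\<forall>S \<subseteq> P. card S = 3 \<longrightarrow> \<not> collinear S)"

definition vertices :: "(real ^ 2) set \<Rightarrow> (real ^ 2) set" where
  "vertices H = {v. v extreme_point_of H}"

text \<open>A convex pentagon is regarded as a region of the plane; its vertices are its extreme
  points. Five extreme points in the plane cannot be collinear, so such a region automatically
  has nonempty interior.\<close>

definition convex_pentagon :: "(real ^ 2) set \<Rightarrow> bool" where
  "convex_pentagon H \<longleftrightarrow> polytope H \<and> card (vertices H) = 5"

definition five_holes :: "(real ^ 2) set \<Rightarrow> (real ^ 2) set set" where
  "five_holes P = {H. convex_pentagon H \<and> vertices H \<subseteq> P \<and> interior H \<inter> P = {}}"

definition first_layer :: "(real ^ 2) set \<Rightarrow> (real ^ 2) set" where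
  "first_layer P = P \<inter> frontier (convex hull P)"

text \<open>Layers are indexed from 1. The value at index 0 is not used.\<close>

fun layer :: "(real ^ 2) set \<Rightarrow> nat \<Rightarrow> (real ^ 2) set" where
  "layer P k = first_layer (P - (\<Union>j\<in>{1..<k}. layer P j))"

declare layer.simps [simp del]

definition num_layers :: "(real ^ 2) set \<Rightarrow> nat" where
  "num_layers P = (LEAST k. P = (\<Union>j\<in>{1..k}. layer P j))"

end

theory Submission
  imports Defs
begin

text \<open>Sort the other points radially around a point \<open>p\<close> of the first layer and cut the order into windows
  of nine consecutive points. Let \<open>p q r\<close> be an empty triangle. If there are points on \<open>p\<close>'s side of the
  line \<open>q r\<close> both radially before \<open>q\<close> and radially after \<open>r\<close>, then \<open>p\<close> is a vertex of a 5-hole with the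
  opposite side \<open>q r\<close>. Otherwise \<open>p\<close> is the radially first or the last of the points on its side of the
  line \<open>q r\<close>, so that \<open>q\<close>, \<open>r\<close> and a bounded choice determine \<open>p\<close>. If the first alternative never
  occurs in a window, then the window contains a 5-hole with two radially consecutive vertices: this is
  a finite statement about the orientations of nine points. Hence each pair of \<open>p\<close> and a window yields a
  5-hole from which the pair can be recovered up to boundedly many choices, which gives the bound with
  the first layer. A 5-hole of an inner part of the layer decomposition is a 5-hole of \<open>P\<close>, and with
  \<open>r k\<close> points left after \<open>k\<close> layers, \<open>(r k - r (k + 1)) * r k \<ge> ((r k)\<^sup>2 - (r (k + 1))\<^sup>2) / 2\<close>; summing
  over the layers, one of them satisfies \<open>(r k - r (k + 1)) * r k \<ge> n\<^sup>2 / (2 * L)\<close>.\<close>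

section \<open>Orientation and holes\<close>

text \<open>Twice the signed area of the triangle \<open>a b c\<close>: positive for
  counterclockwise, negative for clockwise order.\<close>

definition orient :: "real ^ 2 \<Rightarrow> real ^ 2 \<Rightarrow> real ^ 2 \<Rightarrow> real" where
  "orient a b c = (b $ 1 - a $ 1) * (c $ 2 - a $ 2) - (b $ 2 - a $ 2) * (c $ 1 - a $ 1)"

lemma orient_cycle: "orient b c a = orient a b c"
  and orient_swap: "orient b a c = - orient a b c"
  and orient_swap': "orient a c b = - orient a b c"
  by (simp_all add: orient_def algebra_simps)

lemma orient_same [simp]: "orient a a b = 0" "orient a b a = 0" "orient a b b = 0"
  by (simp_all add: orient_def)

lemma orient_neg_perms:
  assumes "orient a b c < 0"
  shows "orient b c a < 0 \<and> orient c a b < 0 \<and> orient b a c > 0 \<and> orient a c b > 0 \<and> orient c b a > 0"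
  using assms by (simp add: orient_def algebra_simps)

lemma orient_combination:
  assumes "x + y + z = 1"
  shows "orient u v (x *\<^sub>R a + y *\<^sub>R b + z *\<^sub>R c) = x * orient u v a + y * orient u v b + z * orient u v c"
proof -
  have z: "z = 1 - x - y" using assms by simp
  show ?thesis unfolding orient_def z by (simp add: algebra_simps)
qed

lemma orient_eq_0_imp_collinear:
  assumes "orient a b c = 0" shows "collinear {a, b, c}"
proof (cases "a = b")
  case False
  have *: "(b $ 1 - a $ 1) * (c $ 2 - a $ 2) = (b $ 2 - a $ 2) * (c $ 1 - a $ 1)"
    using assms by (simp add: orient_def)
  have "\<exists>t. c - a = t *\<^sub>R (b - a)"
  proof (cases "b $ 1 = a $ 1")
    case True
    then have "b $ 2 \<noteq> a $ 2" using False by (auto simp: vec_eq_iff forall_2)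
    then show ?thesis using * True
      by (intro exI[of _ "(c $ 2 - a $ 2) / (b $ 2 - a $ 2)"]) (auto simp: vec_eq_iff forall_2)
  next
    case F: False
    define t where "t = (c $ 1 - a $ 1) / (b $ 1 - a $ 1)"
    have "t * (b $ 1 - a $ 1) = c $ 1 - a $ 1" using F by (simp add: t_def)
    moreover have "t * (b $ 2 - a $ 2) = c $ 2 - a $ 2"
      using * F by (simp add: t_def divide_simps) (simp add: mult.commute)
    ultimately show ?thesis by (intro exI[of _ t]) (simp add: vec_eq_iff forall_2)
  qed
  then have "collinear {0, b - a, c - a}"
    by (auto simp: collinear_lemma)
  then have "collinear {b, a, c}" by (subst collinear_3) (simp_all add: NO_MATCH_def)
  then show ?thesis by (simp add: insert_commute)
qed simp

lemma general_positionD: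
  assumes "general_position P" "a \<in> P" "b \<in> P" "c \<in> P" "a \<noteq> b" "a \<noteq> c" "b \<noteq> c"
  shows "orient a b c \<noteq> 0"
proof
  assume "orient a b c = 0"
  then have "collinear {a, b, c}" by (rule orient_eq_0_imp_collinear)
  moreover have "card {a, b, c} = 3" using assms by simp
  ultimately show False using assms unfolding general_position_def by (metis empty_subsetI insert_subset)
qed

text \<open>A closed half plane is convex, so with \<open>T\<close> it contains the hull of
  \<open>T\<close>. A line through two points thus certifies that \<open>x\<close> lies outside the
  hull, which is how holes are verified below.\<close>

lemma not_in_hull_if_separated:
  assumes "\<And>t. t \<in> T \<Longrightarrow> orient u v t \<le> 0" "orient u v x > 0"
  shows "x \<notin> convex hull T"
proof
  assume "x \<in> convex hull T"
  moreover have "convex {y. orient u v y \<le> 0}"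
  proof (rule convexI)
    fix y z :: "real ^ 2" and s t :: real
    assume yz: "y \<in> {y. orient u v y \<le> 0}" "z \<in> {y. orient u v y \<le> 0}" and st: "0 \<le> s" "0 \<le> t" "s + t = 1"
    have "orient u v (s *\<^sub>R y + t *\<^sub>R z) = s * orient u v y + t * orient u v z"
      using orient_combination[of s t 0 u v y z 0] st by simp
    then show "s *\<^sub>R y + t *\<^sub>R z \<in> {y. orient u v y \<le> 0}"
      using yz st by (simp add: mult_nonneg_nonpos add_nonpos_nonpos)
  qed
  ultimately have "x \<in> {y. orient u v y \<le> 0}"
    using hull_minimal[of T "{y. orient u v y \<le> 0}" convex] assms(1) by auto
  then show False using assms(2) by simp
qed

text \<open>One condition covers both requirements: for \<open>x\<close> in \<open>S\<close> it is
  convex position, for the other \<open>x\<close> it is emptiness, even of the closed pentagon.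
  Counting can then work with vertex sets instead of regions.\<close>

definition hole :: "(real ^ 2) set \<Rightarrow> (real ^ 2) set \<Rightarrow> bool" where
  "hole P S \<longleftrightarrow> S \<subseteq> P \<and> card S = 5 \<and> (\<forall>x\<in>P. x \<notin> convex hull (S - {x}))"

lemma hole_hull:
  assumes "hole P S"
  shows "vertices (convex hull S) = S" "convex hull S \<in> five_holes P"
proof -
  have S: "S \<subseteq> P" "card S = 5" and out: "\<And>x. x \<in> P \<Longrightarrow> x \<notin> convex hull (S - {x})"
    using assms by (auto simp: hole_def)
  have "finite S" using S(2) by (metis card.infinite zero_neq_numeral)
  show v: "vertices (convex hull S) = S"
    unfolding vertices_def using out S(1) \<open>finite S\<close>
    by (subst extreme_point_of_convex_hull_convex_independent) (auto simp: finite_imp_compact)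
  have "x \<notin> interior (convex hull S)" if "x \<in> P" for x
  proof (cases "x \<in> S")
    case True
    then have "x extreme_point_of (convex hull S)" using v by (auto simp: vertices_def)
    then show ?thesis by (rule extreme_point_not_in_interior)
  next
    case False
    then show ?thesis using out[OF that] interior_subset by auto
  qed
  then show "convex hull S \<in> five_holes P"
    using v S \<open>finite S\<close> by (auto simp: five_holes_def convex_pentagon_def polytope_convex_hull)
qed

text \<open>By Krein-Milman a pentagon is the hull of its vertices, so a subset of \<open>P\<close>
  determines it.\<close>

lemma finite_five_holes: "finite P \<Longrightarrow> finite (five_holes P)"
proof (rule finite_subset)
  show "five_holes P \<subseteq> (\<lambda>S. convex hull S) ` Pow P"
  proof
    fix H assume H: "H \<in> five_holes P"
    then have "H = convex hull (vertices H)"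
      unfolding vertices_def five_holes_def convex_pentagon_def
      by (auto intro!: Krein_Milman_Minkowski polytope_imp_compact polytope_imp_convex)
    then show "H \<in> (\<lambda>S. convex hull S) ` Pow P" using H by (auto simp: five_holes_def)
  qed
qed simp

lemma card_holes_le:
  assumes "finite P" shows "card {S. hole P S} \<le> card (five_holes P)"
proof (rule card_inj_on_le[of "\<lambda>S. convex hull S"])
  show "inj_on (\<lambda>S. convex hull S) {S. hole P S}"
    by (rule inj_onI) (metis hole_hull(1) mem_Collect_eq)
qed (use assms hole_hull(2) finite_five_holes in auto)

text \<open>By Caratheodory, \<open>p\<close> would be a convex combination of at most three other
  points. If two of them suffice, \<open>p\<close> equals one of them or is collinear with both;
  otherwise all coefficients are positive and \<open>p\<close> is interior to a triangle, hence to
  the hull of \<open>P\<close>.\<close>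

lemma first_layer_not_in_hull:
  assumes "finite P" "general_position P" "p \<in> first_layer P"
  shows "p \<notin> convex hull (P - {p})"
proof
  assume "p \<in> convex hull (P - {p})"
  then obtain S where S: "finite S" "S \<subseteq> P - {p}" "card S \<le> 3" "p \<in> convex hull S"
    unfolding caratheodory[of "P - {p}"] by auto
  then have "S \<noteq> {}" by auto
  have "\<exists>a b c. S = {a, b, c}"
  proof -
    have "card S = 1 \<or> card S = 2 \<or> card S = 3" using S \<open>S \<noteq> {}\<close> by (auto simp: le_Suc_eq numeral_eq_Suc)
    then show ?thesis by (metis card_1_singletonE card_2_iff card_3_iff insert_absorb2)
  qed
  then obtain a b c where abc: "S = {a, b, c}" by auto
  have P: "a \<in> P" "b \<in> P" "c \<in> P" "p \<in> P" and ne: "a \<noteq> p" "b \<noteq> p" "c \<noteq> p"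
    using S abc assms(3) by (auto simp: first_layer_def)
  obtain x y z where xyz: "0 \<le> x" "0 \<le> y" "0 \<le> z" "x + y + z = 1" "p = x *\<^sub>R a + y *\<^sub>R b + z *\<^sub>R c"
    using S(4) unfolding abc convex_hull_3 by auto
  have pab: "orient u v p = x * orient u v a + y * orient u v b + z * orient u v c" for u v
    unfolding xyz(5) by (rule orient_combination) fact
  have gp: "orient u v w \<noteq> 0" if "{u, v, w} \<subseteq> P" "u \<noteq> v" "u \<noteq> w" "v \<noteq> w" for u v w
    using general_positionD[OF assms(2)] that by auto
  have two: False if "p = s *\<^sub>R u + t *\<^sub>R v" "s + t = 1" "u \<in> {a, b, c}" "v \<in> {a, b, c}" for u v s t
  proof (cases "u = v")
    case True
    then have "p = u" using that(1,2) by (metis scaleR_add_left scaleR_one)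
    then show False using that ne by auto
  next
    case False
    have "orient u v p = 0" using orient_combination[of s t 0 u v u v 0] that by simp
    then show False using gp[of u v p] that P ne False by auto
  qed
  show False
  proof (cases "a \<noteq> b \<and> a \<noteq> c \<and> b \<noteq> c")
    case False
    then consider "a = b" | "a = c" | "b = c" by auto
    then show False
    proof cases
      case 1 then show False using two[of "x + y" a z c] xyz by (simp add: scaleR_add_left)
    next
      case 2 then show False using two[of "x + z" a y b] xyz by (simp add: scaleR_add_left algebra_simps)
    next
      case 3 then show False using two[of x a "y + z" b] xyz by (simp add: scaleR_add_left algebra_simps)
    qed
  next
    case True
    have "x \<noteq> 0" using two[of y b z c] xyz by auto
    moreover have "y \<noteq> 0" using two[of x a z c] xyz by auto
    moreover have "z \<noteq> 0" using two[of x a y b] xyz by auto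
    moreover have "\<not> collinear {a, b, c}"
      using assms(2) P True unfolding general_position_def
      by (metis (no_types, lifting) card_3_iff empty_subsetI insert_subset)
    ultimately have "0 < x" "0 < y" "0 < z" "\<not> collinear {a, b, c}" using xyz by auto
    then have "p \<in> interior (convex hull {a, b, c})"
      unfolding xyz(5) using xyz(4) by (subst interior_convex_hull_3_minimal) auto
    moreover have "interior (convex hull {a, b, c}) \<subseteq> interior (convex hull P)"
      using P by (intro interior_mono hull_mono) auto
    ultimately show False using assms(3) by (auto simp: first_layer_def frontier_def)
  qed
qed

section \<open>Points sorted around an extreme point\<close>

text \<open>At most one sign change in the sequence \<open>abc\<close>, \<open>abd\<close>, \<open>acd\<close>, \<open>bcd\<close> (the signotope axiom).\<close>

definition alternation :: "(nat \<Rightarrow> nat \<Rightarrow> nat \<Rightarrow> bool) \<Rightarrow> nat \<Rightarrow> nat \<Rightarrow> nat \<Rightarrow> nat \<Rightarrow> bool" where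
  "alternation X a b c d \<longleftrightarrow>
     (X a b c = X a c d \<longrightarrow> X a b d = X a b c) \<and>
     (X a b c = X b c d \<longrightarrow> X a b d = X a b c \<and> X a c d = X a b c) \<and>
     (X a b d = X b c d \<longrightarrow> X a c d = X a b d)"

locale fan =
  fixes P :: "(real ^ 2) set" and p :: "real ^ 2" and q :: "nat \<Rightarrow> real ^ 2" and m :: nat
  assumes gp: "general_position P"
    and p_in: "p \<in> P"
    and p_extreme: "p \<notin> convex hull (P - {p})"
    and bij: "bij_betw q {..<m} (P - {p})"
    and sorted: "\<And>i j. i < j \<Longrightarrow> j < m \<Longrightarrow> orient p (q i) (q j) < 0"
begin

text \<open>Projectively, put \<open>p\<close> at infinity below: the \<open>q i\<close> are then numbered from left to right,
  \<open>cup i j k\<close> says that \<open>q j\<close> lies below the chord from \<open>q i\<close> to \<open>q k\<close>, and the triangle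
  \<open>p\<close>, \<open>q i\<close>, \<open>q j\<close> is empty iff no \<open>q k\<close> with \<open>i < k < j\<close> satisfies \<open>cup i k j\<close>.\<close>

definition cup :: "nat \<Rightarrow> nat \<Rightarrow> nat \<Rightarrow> bool" where
  "cup i j k \<longleftrightarrow> orient (q i) (q j) (q k) > 0"

lemma q_in: "i < m \<Longrightarrow> q i \<in> P" "i < m \<Longrightarrow> q i \<noteq> p"
  using bij by (auto simp: bij_betw_def)

lemma q_eq_iff: "i < m \<Longrightarrow> j < m \<Longrightarrow> q i = q j \<longleftrightarrow> i = j"
  using bij by (auto simp: bij_betw_def inj_on_def)

lemma point_cases:
  assumes "x \<in> P"
  obtains "x = p" | k where "k < m" "x = q k"
  using assms bij unfolding bij_betw_def by (metis DiffI imageE lessThan_iff singletonD)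

lemma orient_nonzero:
  assumes "i < j" "j < k" "k < m"
  shows "orient (q i) (q j) (q k) \<noteq> 0"
  using assms by (intro general_positionD[OF gp]) (auto simp: q_in q_eq_iff)

lemma not_cup_iff:
  assumes "i < j" "j < k" "k < m"
  shows "\<not> cup i j k \<longleftrightarrow> orient (q i) (q j) (q k) < 0"
  using orient_nonzero[OF assms] by (auto simp: cup_def)

text \<open>Three-term Grassmann-Pluecker relations on \<open>p\<close> and the four points: all
  factors containing \<open>p\<close> are negative, so each orientation on a left-hand side is a
  positive combination of the two on the right and inherits their common sign.\<close>

lemma alternation_cup:
  assumes "a < b" "b < c" "c < d" "d < m"
  shows "alternation cup a b c d"
proof -
  define A B C D where "A = orient (q b) (q c) (q d)" and "B = orient (q a) (q c) (q d)"
    and "C = orient (q a) (q b) (q d)" and "D = orient (q a) (q b) (q c)"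
  have s: "orient p (q a) (q b) < 0" "orient p (q a) (q c) < 0" "orient p (q a) (q d) < 0"
    "orient p (q b) (q c) < 0" "orient p (q b) (q d) < 0" "orient p (q c) (q d) < 0"
    using assms by (auto intro!: sorted)
  have i1: "C * orient p (q a) (q c) = B * orient p (q a) (q b) + D * orient p (q a) (q d)"
    and i2: "C * orient p (q b) (q c) = A * orient p (q a) (q b) + D * orient p (q b) (q d)"
    and i3: "B * orient p (q b) (q c) = A * orient p (q a) (q c) + D * orient p (q c) (q d)"
    and i4: "B * orient p (q b) (q d) = A * orient p (q a) (q d) + C * orient p (q c) (q d)"
    by (simp_all add: A_def B_def C_def D_def orient_def algebra_simps)
  have pos: "z > 0" if "z * u = x * v + y * w" "x > 0" "y > 0" "u < 0" "v < 0" "w < 0" for x y z u v w :: real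
  proof -
    have "z * u < 0" using that by (simp add: add_neg_neg mult_pos_neg)
    then show ?thesis using \<open>u < 0\<close> by (simp add: mult_less_0_iff)
  qed
  have neg: "z < 0" if "z * u = x * v + y * w" "x < 0" "y < 0" "u < 0" "v < 0" "w < 0" for x y z u v w :: real
    using pos[of "- z" u "- x" v "- y" w] that by simp
  have ne: "A \<noteq> 0" "B \<noteq> 0" "C \<noteq> 0" "D \<noteq> 0"
    unfolding A_def B_def C_def D_def using assms by (simp_all add: orient_nonzero)
  have X: "cup b c d \<longleftrightarrow> A > 0" "cup a c d \<longleftrightarrow> B > 0" "cup a b d \<longleftrightarrow> C > 0" "cup a b c \<longleftrightarrow> D > 0"
    by (simp_all add: cup_def A_def B_def C_def D_def)
  have "B > 0 \<Longrightarrow> D > 0 \<Longrightarrow> C > 0" "B < 0 \<Longrightarrow> D < 0 \<Longrightarrow> C < 0"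
    using pos[OF i1 _ _ s(2,1,3)] neg[OF i1 _ _ s(2,1,3)] by auto
  moreover have "A > 0 \<Longrightarrow> D > 0 \<Longrightarrow> C > 0" "A < 0 \<Longrightarrow> D < 0 \<Longrightarrow> C < 0"
    using pos[OF i2 _ _ s(4,1,5)] neg[OF i2 _ _ s(4,1,5)] by auto
  moreover have "A > 0 \<Longrightarrow> D > 0 \<Longrightarrow> B > 0" "A < 0 \<Longrightarrow> D < 0 \<Longrightarrow> B < 0"
    using pos[OF i3 _ _ s(4,2,6)] neg[OF i3 _ _ s(4,2,6)] by auto
  moreover have "A > 0 \<Longrightarrow> C > 0 \<Longrightarrow> B > 0" "A < 0 \<Longrightarrow> C < 0 \<Longrightarrow> B < 0"
    using pos[OF i4 _ _ s(5,3,6)] neg[OF i4 _ _ s(5,3,6)] by auto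
  ultimately show ?thesis using ne unfolding alternation_def X by argo
qed

lemma radial_separation:
  assumes "finite J" "J \<subseteq> {..<m}" "k < m" "(\<forall>j\<in>J. k < j) \<or> (\<forall>j\<in>J. j < k)"
  shows "q k \<notin> convex hull (q ` J)"
proof (cases "J = {}")
  case False
  from assms(4) show ?thesis
  proof
    assume k: "\<forall>j\<in>J. k < j"
    define j where "j = Min J"
    have j: "j \<in> J" "\<And>i. i \<in> J \<Longrightarrow> j \<le> i" using False assms(1) by (auto simp: j_def)
    show ?thesis
    proof (rule not_in_hull_if_separated[of _ p "q j"])
      show "orient p (q j) (q k) > 0"
        using sorted[of k j] k j assms(2) orient_neg_perms[of p "q k" "q j"] by auto
      show "orient p (q j) t \<le> 0" if t: "t \<in> q ` J" for t
      proof -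
        obtain i where i: "i \<in> J" "t = q i" using t by auto
        then have "j = i \<or> j < i" "i < m" using j assms(2) by (auto simp: le_less)
        then show ?thesis using sorted[of j i] i by auto
      qed
    qed
  next
    assume k: "\<forall>j\<in>J. j < k"
    define j where "j = Max J"
    have j: "j \<in> J" "\<And>i. i \<in> J \<Longrightarrow> i \<le> j" using False assms(1) by (auto simp: j_def)
    show ?thesis
    proof (rule not_in_hull_if_separated[of _ "q j" p])
      show "orient (q j) p (q k) > 0"
        using sorted[of j k] k j assms(3) orient_neg_perms[of p "q j" "q k"] by auto
      show "orient (q j) p t \<le> 0" if t: "t \<in> q ` J" for t
      proof -
        obtain i where i: "i \<in> J" "t = q i" using t by auto
        then have "i = j \<or> i < j" "j < m" using j assms(2) by (auto simp: le_less)
        then show ?thesis using sorted[of i j] i orient_neg_perms[of p "q i" "q j"] by auto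
      qed
    qed
  qed
qed simp

text \<open>Take the points below the line \<open>q i q j\<close> that are radially nearest to the empty triangle
  \<open>p\<close>, \<open>q i\<close>, \<open>q j\<close> on either side: the pentagon is a fan of three empty triangles at \<open>p\<close>.\<close>

lemma empty_pentagon_at_apex:
  assumes ij: "i < j" "j < m" and vis: "\<And>k. i < k \<Longrightarrow> k < j \<Longrightarrow> \<not> cup i k j"
    and lft: "k < i" "\<not> cup k i j" and rgt: "j < l" "l < m" "\<not> cup i j l"
  shows "\<exists>S. hole P S \<and> p \<in> S \<and> q i \<in> S"
proof -
  \<comment> \<open>\<open>A\<close> and \<open>B\<close> index the points on the side of
    \<open>p\<close> of the line through \<open>q i\<close> and \<open>q j\<close>, radially before
    \<open>q i\<close> and after \<open>q j\<close>; \<open>a\<close> and \<open>e\<close> are the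
    nearest ones.\<close>
  define A where "A = {k. k < i \<and> \<not> cup k i j}"
  define B where "B = {l. j < l \<and> l < m \<and> \<not> cup i j l}"
  define a where "a = Max A"
  define e where "e = Min B"
  have "finite A" "A \<noteq> {}" "finite B" "B \<noteq> {}" using lft rgt by (auto simp: A_def B_def)
  then have "a \<in> A" "e \<in> B" and a_max: "\<And>k. k \<in> A \<Longrightarrow> k \<le> a" and e_min: "\<And>k. k \<in> B \<Longrightarrow> e \<le> k"
    by (simp_all add: a_def e_def)
  then have ord: "a < i" "i < j" "j < e" "e < m" and caps: "\<not> cup a i j" "\<not> cup i j e"
    using ij by (auto simp: A_def B_def)
  have lt: "a < j" "a < e" "i < e" "a < m" "i < m" "j < m" using ord by auto
  have caps': "\<not> cup a i e" "\<not> cup a j e"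
    using caps alternation_cup[OF ord] by (auto simp: alternation_def)
  \<comment> \<open>Maximality of \<open>a\<close> puts \<open>q k\<close> above the line through
    \<open>q i\<close> and \<open>q j\<close>; alternation then puts it above the edge from
    \<open>q a\<close> to \<open>q i\<close>.\<close>
  have gap1: "\<not> cup a k i" if "a < k" "k < i" for k
  proof -
    have "cup k i j" using a_max[of k] that by (auto simp: A_def)
    then show ?thesis using alternation_cup[of a k i j] that ord caps by (auto simp: alternation_def)
  qed
  have gap2: "\<not> cup j k e" if "j < k" "k < e" for k
  proof -
    have "cup i j k" using e_min[of k] that ord by (auto simp: B_def)
    then show ?thesis using alternation_cup[of i j k e] that ord caps by (auto simp: alternation_def)
  qed
  define S where "S = {p, q a, q i, q j, q e}"
  note o = caps[unfolded not_cup_iff[OF ord(1,2) lt(6)] not_cup_iff[OF ord(2,3,4)]]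
    caps'[unfolded not_cup_iff[OF ord(1) lt(3) ord(4)] not_cup_iff[OF lt(1) ord(3,4)]]
  note s = sorted[OF ord(1) lt(5)] sorted[OF lt(1,6)] sorted[OF lt(2) ord(4)]
    sorted[OF ord(2) lt(6)] sorted[OF lt(3) ord(4)] sorted[OF ord(3,4)]
  have sep: "x \<notin> convex hull (S - {x})"
    if "orient u v x > 0" "\<And>t. t \<in> S \<Longrightarrow> t = x \<or> orient u v t \<le> 0" for u v x
    by (rule not_in_hull_if_separated[of _ u v]) (use that in auto)
  note sg = o[THEN orient_neg_perms] s[THEN orient_neg_perms] o s
  have "x \<notin> convex hull (S - {x})" if "x \<in> P" for x
    using that
  proof (cases rule: point_cases)
    case 1
    have "S - {p} \<subseteq> P - {p}" using lt ord by (auto simp: S_def q_in)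
    then show ?thesis using p_extreme hull_mono[of "S - {p}" "P - {p}" convex] 1 by auto
  next
    case (2 k)
    \<comment> \<open>A point that is not a vertex is cut off by the edge of its radial sector, or
      by an edge at \<open>p\<close> outside all sectors. A vertex is cut off by the diagonal
      joining its two neighbours.\<close>
    consider "k < a" | "k = a" | "a < k" "k < i" | "k = i" | "i < k" "k < j" | "k = j"
      | "j < k" "k < e" | "k = e" | "e < k" by linarith
    then show ?thesis
    proof cases
      case 1
      have "orient p (q k) (q a) < 0" using 1 lt by (intro sorted)
      then show ?thesis
        by (intro sep[of p "q a"]) (auto simp: S_def 2 sg less_imp_le dest: orient_neg_perms)
    next
      case k: 2
      then show ?thesis
        by (intro sep[of p "q i"]) (auto simp: S_def 2 sg less_imp_le)
    next
      case 3
      have "orient (q a) (q k) (q i) < 0" using gap1[OF 3] not_cup_iff[OF 3 lt(5)] by simp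
      then show ?thesis
        by (intro sep[of "q a" "q i"]) (auto simp: S_def 2 sg less_imp_le dest: orient_neg_perms)
    next
      case 4
      then show ?thesis
        by (intro sep[of "q a" "q j"]) (auto simp: S_def 2 sg less_imp_le)
    next
      case 5
      have "orient (q i) (q k) (q j) < 0" using vis[OF 5] not_cup_iff[OF 5 lt(6)] by simp
      then show ?thesis
        by (intro sep[of "q i" "q j"]) (auto simp: S_def 2 sg less_imp_le dest: orient_neg_perms)
    next
      case 6
      then show ?thesis
        by (intro sep[of "q i" "q e"]) (auto simp: S_def 2 sg less_imp_le)
    next
      case 7
      have "orient (q j) (q k) (q e) < 0" using gap2[OF 7] not_cup_iff[OF 7 ord(4)] by simp
      then show ?thesis
        by (intro sep[of "q j" "q e"]) (auto simp: S_def 2 sg less_imp_le dest: orient_neg_perms)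
    next
      case 8
      then show ?thesis
        by (intro sep[of "q j" p]) (auto simp: S_def 2 sg less_imp_le)
    next
      case 9
      have "orient p (q e) (q k) < 0" using 9 2 by (intro sorted)
      then show ?thesis
        by (intro sep[of "q e" p]) (auto simp: S_def 2 sg less_imp_le dest: orient_neg_perms)
    qed
  qed
  moreover have "S \<subseteq> P" "card S = 5"
    using lt ord p_in by (auto simp: S_def q_in q_eq_iff card_insert_if q_in(2)[symmetric])
  ultimately show ?thesis unfolding hole_def by (intro exI[of _ S]) (auto simp: S_def)
qed

end

section \<open>Empty polygons bounded by a lower and an upper chain\<close>

text \<open>\<open>D\<close> is the lower and \<open>U\<close> the upper boundary chain; they share their two end points.\<close>

definition empty_polygon :: "(nat \<Rightarrow> nat \<Rightarrow> nat \<Rightarrow> bool) \<Rightarrow> nat set \<Rightarrow> nat set \<Rightarrow> bool" where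
  "empty_polygon X D U \<longleftrightarrow> (\<exists>a e. a < e \<and> {a, e} \<subseteq> D \<inter> U \<and> (\<forall>s\<in>D \<union> U. a \<le> s \<and> s \<le> e) \<and>
     (\<forall>u\<in>D. \<forall>v\<in>D. \<forall>w\<in>D. u < v \<longrightarrow> v < w \<longrightarrow> X u v w) \<and>
     (\<forall>u\<in>U. \<forall>v\<in>U. \<forall>w\<in>U. u < v \<longrightarrow> v < w \<longrightarrow> \<not> X u v w) \<and>
     (\<forall>k. a < k \<longrightarrow> k < e \<longrightarrow> k \<notin> D \<union> U \<longrightarrow>
        (\<exists>u\<in>D. \<exists>v\<in>D. u < k \<and> k < v \<and> (\<forall>s\<in>D. s \<le> u \<or> v \<le> s) \<and> X u k v) \<or>
        (\<exists>u\<in>U. \<exists>v\<in>U. u < k \<and> k < v \<and> (\<forall>s\<in>U. s \<le> u \<or> v \<le> s) \<and> \<not> X u k v)))"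

text \<open>The axiom only compares signs. This lets statements about lower chains be applied to
  upper chains with \<open>X\<close> negated.\<close>

lemma alternation_not: "alternation (\<lambda>i j k. \<not> X i j k) a b c d \<longleftrightarrow> alternation X a b c d"
  by (auto simp: alternation_def)

text \<open>Geometrically, with \<open>X\<close> as \<open>cup\<close>: the ends \<open>a\<close>
  and \<open>e\<close> of a lower chain lie on or above the line \<open>u v\<close>, hence so does
  the chord between them. As \<open>s\<close> lies above that chord, it lies above the line
  \<open>u v\<close>; the three conclusions express this for the three positions of
  \<open>s\<close>.\<close>

lemma chord_side:
  assumes alt: "\<And>a b c d. a < b \<Longrightarrow> b < c \<Longrightarrow> c < d \<Longrightarrow> d < m \<Longrightarrow> alternation X a b c d"
    and chain: "\<And>u v w. u \<in> D \<Longrightarrow> v \<in> D \<Longrightarrow> w \<in> D \<Longrightarrow> u < v \<Longrightarrow> v < w \<Longrightarrow> X u v w"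
    and D: "a \<in> D" "e \<in> D" "u \<in> D" "v \<in> D" "a \<le> u" "u < v" "v \<le> e" "e < m"
    and s: "a < s" "s < e" "\<not> X a s e"
  shows "s < u \<Longrightarrow> X s u v" "u < s \<Longrightarrow> s < v \<Longrightarrow> \<not> X u s v" "v < s \<Longrightarrow> X u v s"
proof -
  show "X s u v" if "s < u"
  proof -
    have 1: "X a u v" "X a u e" using that D s chain by auto
    have "X s u e" using alt[of a s u e] 1 that D s by (auto simp: alternation_def)
    moreover have "X u v e" if "v \<noteq> e" using chain[of u v e] D that by auto
    ultimately show ?thesis
      using alt[of s u v e] alt[of a s u v] alt[of a s u e] alt[of a s v e] 1 that D s chain[of a v e]
      by (cases "v = e") (auto simp: alternation_def)
  qed
  show "\<not> X u s v" if "u < s" "s < v"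
  proof -
    have 1: "u \<noteq> a \<Longrightarrow> X a u e" "v \<noteq> e \<Longrightarrow> X a v e" "v \<noteq> e \<Longrightarrow> X u v e" using that D s chain by auto
    have 2: "\<not> X u s e" using alt[of a u s e] 1 that D s by (cases "u = a") (auto simp: alternation_def)
    then show ?thesis using alt[of u s v e] 1 that D s by (cases "v = e") (auto simp: alternation_def)
  qed
  show "X u v s" if "v < s"
  proof -
    have 1: "X u v e" "X a v e" using that D s chain by auto
    have "X a v s" using alt[of a v s e] 1 that D s by (auto simp: alternation_def)
    moreover have "X a u v" if "u \<noteq> a" using chain[of a u v] D that by auto
    ultimately show ?thesis
      using alt[of u v s e] alt[of a u v s] alt[of a v s e] alt[of a u s e] 1 that D s chain[of a u e]
      by (cases "u = a") (auto simp: alternation_def)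
  qed
qed

context fan
begin

text \<open>The line through \<open>q u\<close> and \<open>q v\<close> separates: \<open>q k\<close>
  is strictly below it, and the disjunction places every point of \<open>J\<close> on or above
  it.\<close>

lemma separation_below:
  assumes "J \<subseteq> {..<m}" "u < k" "k < v" "v < m" "cup u k v"
    and "\<And>s. s \<in> J \<Longrightarrow> s < u \<and> cup s u v \<or> s = u \<or> u < s \<and> s < v \<and> \<not> cup u s v \<or> s = v \<or> v < s \<and> cup u v s"
  shows "q k \<notin> convex hull (q ` J)"
proof (rule not_in_hull_if_separated[of _ "q v" "q u"])
  show "orient (q v) (q u) (q k) > 0"
    using assms(5) orient_cycle[of "q u" "q k" "q v"] by (simp add: cup_def orient_cycle)
  fix t assume "t \<in> q ` J"
  then obtain s where s: "s \<in> J" "t = q s" by auto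
  consider "s < u" "cup s u v" | "s = u" | "u < s" "s < v" "\<not> cup u s v" | "s = v" | "v < s" "cup u v s"
    using assms(6)[OF s(1)] by auto
  then show "orient (q v) (q u) t \<le> 0"
  proof cases
    case 1 then show ?thesis
      using orient_swap[of "q u" "q v" "q s"] by (simp add: s cup_def orient_cycle)
  next
    case 3 then show ?thesis
      using orient_neg_perms[of "q u" "q s" "q v"] not_cup_iff[of u s v] assms(4)
        orient_swap[of "q u" "q v" "q s"] by (simp add: s orient_cycle)
  next
    case 5 then show ?thesis
      using orient_swap[of "q u" "q v" "q s"] by (simp add: s cup_def)
  qed (simp_all add: s)
qed

lemma separation_above:
  assumes "J \<subseteq> {..<m}" "u < k" "k < v" "v < m" "\<not> cup u k v"
    and "\<And>s. s \<in> J \<Longrightarrow> s < u \<and> \<not> cup s u v \<or> s = u \<or> u < s \<and> s < v \<and> cup u s v \<or> s = v \<or> v < s \<and> \<not> cup u v s"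
  shows "q k \<notin> convex hull (q ` J)"
proof (rule not_in_hull_if_separated[of _ "q u" "q v"])
  show "orient (q u) (q v) (q k) > 0"
    using assms not_cup_iff[of u k v] orient_neg_perms[of "q u" "q k" "q v"] by auto
  fix t assume "t \<in> q ` J"
  then obtain s where s: "s \<in> J" "t = q s" by auto
  then have "s < m" using assms(1) by auto
  consider "s < u" "\<not> cup s u v" | "s = u" | "u < s" "s < v" "cup u s v" | "s = v" | "v < s" "\<not> cup u v s"
    using assms(6)[OF s(1)] by auto
  then show "orient (q u) (q v) t \<le> 0"
  proof cases
    case 1 then show ?thesis
      using not_cup_iff[of s u v] assms orient_neg_perms[of "q s" "q u" "q v"] by (auto simp: s)
  next
    case 3 then show ?thesis
      using orient_swap'[of "q u" "q v" "q s"] by (simp add: s cup_def)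
  next
    case 5 then show ?thesis
      using not_cup_iff[of u v s] assms \<open>s < m\<close> by (simp add: s)
  qed (simp_all add: s)
qed

text \<open>Points radially outside the range of the polygon are separated by a line through
  \<open>p\<close>. A gap point is separated by the chain edge that spans it on the outer side, an
  inner vertex by the chord between its neighbours in its chain.\<close>

lemma hole_if_empty_polygon:
  assumes "empty_polygon cup D U" "D \<union> U \<subseteq> {..<m}" "card (D \<union> U) = 5"
  shows "hole P (q ` (D \<union> U))"
proof -
  obtain a e where ae: "a < e" "a \<in> D" "a \<in> U" "e \<in> D" "e \<in> U" "\<And>s. s \<in> D \<union> U \<Longrightarrow> a \<le> s \<and> s \<le> e"
    and cups: "\<And>u v w. u \<in> D \<Longrightarrow> v \<in> D \<Longrightarrow> w \<in> D \<Longrightarrow> u < v \<Longrightarrow> v < w \<Longrightarrow> cup u v w"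
    and caps: "\<And>u v w. u \<in> U \<Longrightarrow> v \<in> U \<Longrightarrow> w \<in> U \<Longrightarrow> u < v \<Longrightarrow> v < w \<Longrightarrow> \<not> cup u v w"
    and gap: "\<And>k. a < k \<Longrightarrow> k < e \<Longrightarrow> k \<notin> D \<union> U \<Longrightarrow>
        (\<exists>u\<in>D. \<exists>v\<in>D. u < k \<and> k < v \<and> (\<forall>s\<in>D. s \<le> u \<or> v \<le> s) \<and> cup u k v) \<or>
        (\<exists>u\<in>U. \<exists>v\<in>U. u < k \<and> k < v \<and> (\<forall>s\<in>U. s \<le> u \<or> v \<le> s) \<and> \<not> cup u k v)"
    using assms(1) unfolding empty_polygon_def by (elim exE conjE) (auto 0 3)
  have fin: "finite (D \<union> U)" using assms(3) by (metis card.infinite zero_neq_numeral)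
  have "e < m" using ae assms(2) by auto
  have neighbours: "\<exists>u\<in>C. \<exists>v\<in>C. u < k \<and> k < v \<and> (\<forall>s\<in>C - {k}. s \<le> u \<or> v \<le> s)"
    if "finite C" "a \<in> C" "e \<in> C" "a < k" "k < e" for C k
  proof (intro bexI conjI ballI)
    let ?u = "Max {s \<in> C. s < k}" and ?v = "Min {s \<in> C. k < s}"
    have "?u \<in> {s \<in> C. s < k}" "?v \<in> {s \<in> C. k < s}"
      using that by (intro Max_in Min_in; force)+
    then show "?u \<in> C" "?u < k" "?v \<in> C" "k < ?v" by auto
    show "s \<le> ?u \<or> ?v \<le> s" if "s \<in> C - {k}" for s
      using that \<open>finite C\<close> by (cases "s < k") auto
  qed
  \<comment> \<open>Removing \<open>k\<close> from \<open>D\<close> lets one claim serve both for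
    vertices of the lower chain and for gap points below it.\<close>
  have below: "q k \<notin> convex hull (q ` (D \<union> U - {k}))"
    if k: "a < k" "k < e" and uv: "u \<in> D" "v \<in> D" "u < k" "k < v" "\<forall>s\<in>D - {k}. s \<le> u \<or> v \<le> s" "cup u k v" for k u v
  proof (rule separation_below[of _ u k v])
    fix s assume s: "s \<in> D \<union> U - {k}"
    show "s < u \<and> cup s u v \<or> s = u \<or> u < s \<and> s < v \<and> \<not> cup u s v \<or> s = v \<or> v < s \<and> cup u v s"
    proof (cases "s \<in> D")
      case True
      then have "s \<le> u \<or> v \<le> s" using uv(5) s by blast
      then show ?thesis using cups[of s u v] cups[of u v s] True uv by (auto simp: le_less)
    next
      case False
      \<comment> \<open>A vertex outside the lower chain is an inner vertex of the upper chain and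
        so lies above the chord joining the common end points, as \<open>chord_side\<close>
        requires.\<close>
      then have "a < s" "s < e" "\<not> cup a s e"
        using s ae caps[of a s e] by (auto simp: order.strict_iff_order)
      moreover have "a \<le> u" "u < v" "v \<le> e" using uv ae by auto
      moreover have "s \<noteq> u" "s \<noteq> v" using False uv by auto
      moreover note chord_side[of m cup D a e u v s, OF alternation_cup cups ae(2,4) uv(1,2) _ _ _ \<open>e < m\<close>]
      ultimately show ?thesis by (cases s u rule: linorder_cases; cases s v rule: linorder_cases) simp_all
    qed
  qed (use assms uv in auto)
  have above: "q k \<notin> convex hull (q ` (D \<union> U - {k}))"
    if k: "a < k" "k < e" and uv: "u \<in> U" "v \<in> U" "u < k" "k < v" "\<forall>s\<in>U - {k}. s \<le> u \<or> v \<le> s" "\<not> cup u k v" for k u v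
  proof (rule separation_above[of _ u k v])
    fix s assume s: "s \<in> D \<union> U - {k}"
    show "s < u \<and> \<not> cup s u v \<or> s = u \<or> u < s \<and> s < v \<and> cup u s v \<or> s = v \<or> v < s \<and> \<not> cup u v s"
    proof (cases "s \<in> U")
      case True
      then have "s \<le> u \<or> v \<le> s" using uv(5) s by blast
      then show ?thesis using caps[of s u v] caps[of u v s] True uv by (auto simp: le_less)
    next
      case False
      then have "a < s" "s < e" "cup a s e"
        using s ae cups[of a s e] by (auto simp: order.strict_iff_order)
      moreover have "a \<le> u" "u < v" "v \<le> e" using uv ae by auto
      moreover have "s \<noteq> u" "s \<noteq> v" using False uv by auto
      \<comment> \<open>Negating \<open>cup\<close> exchanges above and below, so
        \<open>chord_side\<close> applies to the upper chain.\<close>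
      moreover have "alternation (\<lambda>i j k. \<not> cup i j k) a b c d" if "a < b" "b < c" "c < d" "d < m" for a b c d
        using alternation_cup that by (simp add: alternation_not)
      moreover note chord_side[of m "\<lambda>i j k. \<not> cup i j k" U a e u v s, OF _ caps ae(3,5) uv(1,2) _ _ _ \<open>e < m\<close>]
      ultimately show ?thesis by (cases s u rule: linorder_cases; cases s v rule: linorder_cases) simp_all
    qed
  qed (use assms uv in auto)
  have main: "q k \<notin> convex hull (q ` (D \<union> U - {k}))" if "k < m" for k
  proof -
    consider "k \<le> a" | "e \<le> k" | "a < k" "k < e" "k \<in> D" | "a < k" "k < e" "k \<in> U"
      | "a < k" "k < e" "k \<notin> D \<union> U" by fastforce
    then show ?thesis
    proof cases
      case 1
      then have "\<forall>j\<in>D \<union> U - {k}. k < j" using ae(6) by fastforce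
      then show ?thesis using fin assms(2) that by (intro radial_separation) auto
    next
      case 2
      then have "\<forall>j\<in>D \<union> U - {k}. j < k" using ae(6) by fastforce
      then show ?thesis using fin assms(2) that by (intro radial_separation) auto
    next
      case 3
      then obtain u v where uv: "u \<in> D" "v \<in> D" "u < k" "k < v" "\<forall>s\<in>D - {k}. s \<le> u \<or> v \<le> s"
        using neighbours[of D k] fin ae by auto
      then show ?thesis using below[OF 3(1,2) uv] cups[of u k v] 3 by auto
    next
      case 4
      then obtain u v where uv: "u \<in> U" "v \<in> U" "u < k" "k < v" "\<forall>s\<in>U - {k}. s \<le> u \<or> v \<le> s"
        using neighbours[of U k] fin ae by auto
      then show ?thesis using above[OF 4(1,2) uv] caps[of u k v] 4 by auto
    next
      case 5
      then show ?thesis using gap[OF 5] below[OF 5(1,2)] above[OF 5(1,2)] by blast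
    qed
  qed
  have inj: "inj_on q {..<m}" using bij by (auto simp: bij_betw_def)
  have "x \<notin> convex hull (q ` (D \<union> U) - {x})" if "x \<in> P" for x
    using that
  proof (cases rule: point_cases)
    case 1
    have "q ` (D \<union> U) - {p} \<subseteq> P - {p}" using assms(2) by (auto simp: q_in)
    then show ?thesis using p_extreme hull_mono[of "q ` (D \<union> U) - {p}" "P - {p}" convex] 1 by auto
  next
    case (2 k)
    have "q ` (D \<union> U) - {q k} = q ` (D \<union> U - {k})"
      using assms(2) 2 q_eq_iff by auto
    then show ?thesis using main[OF 2(1)] 2 by simp
  qed
  moreover have "card (q ` (D \<union> U)) = 5"
    using assms card_image[OF inj_on_subset[OF inj assms(2)]] by simp
  moreover have "q ` (D \<union> U) \<subseteq> P" using assms(2) by (auto simp: q_in)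
  ultimately show ?thesis by (simp add: hole_def)
qed

end

section \<open>Nine radially consecutive points\<close>

context
  fixes X :: "nat \<Rightarrow> nat \<Rightarrow> nat \<Rightarrow> bool" and a b c d e :: nat
  assumes ord: "a < b" "b < c" "c < d" "d < e"
    and alt: "alternation X a b c d" "alternation X a b c e" "alternation X a b d e"
      "alternation X a c d e" "alternation X b c d e"
begin

lemma ord_closed: "a < c" "a < d" "a < e" "b < d" "b < e" "c < e"
  using ord by auto

lemmas ord_simps = ord ord_closed ord[THEN less_imp_le] ord_closed[THEN less_imp_le]
  ord[THEN less_not_sym] ord_closed[THEN less_not_sym]

lemma gap_cases:
  assumes "a < k" "k < e" "k \<notin> {a, b, c, d, e}"
  obtains "a < k" "k < b" "k < c" "k < d" "k < e" | "a < k" "b < k" "k < c" "k < d" "k < e"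
    | "a < k" "b < k" "c < k" "k < d" "k < e" | "a < k" "b < k" "c < k" "d < k" "k < e"
  using assms ord by fastforce

text \<open>A shape assigns each of \<open>b\<close>, \<open>c\<close>, \<open>d\<close> to the
  lower or the upper chain. The assumed triples force the remaining ones by alternation. Each gap
  assumption says that a point below the upper edge over the gap is also below the lower edge, so it
  is not inside.\<close>

lemma cup_pentagon:
  assumes "X a b c" "X b c d" "X c d e"
    and gaps: "\<And>k. a < k \<Longrightarrow> k < b \<Longrightarrow> X a k e \<longrightarrow> X a k b"
      "\<And>k. b < k \<Longrightarrow> k < c \<Longrightarrow> X a k e \<longrightarrow> X b k c"
      "\<And>k. c < k \<Longrightarrow> k < d \<Longrightarrow> X a k e \<longrightarrow> X c k d"
      "\<And>k. d < k \<Longrightarrow> k < e \<Longrightarrow> X a k e \<longrightarrow> X d k e"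
  shows "empty_polygon X {a, b, c, d, e} {a, e}"
proof -
  have triples: "X a b c" "X a b d" "X a b e" "X a c d" "X a c e" "X a d e" "X b c d" "X b c e" "X b d e" "X c d e"
    using assms(1-3) alt unfolding alternation_def by sat+
  have "(\<exists>u\<in>{a, b, c, d, e}. \<exists>v\<in>{a, b, c, d, e}. u < k \<and> k < v \<and> (\<forall>s\<in>{a, b, c, d, e}. s \<le> u \<or> v \<le> s) \<and> X u k v) \<or>
      (\<exists>u\<in>{a, e}. \<exists>v\<in>{a, e}. u < k \<and> k < v \<and> (\<forall>s\<in>{a, e}. s \<le> u \<or> v \<le> s) \<and> \<not> X u k v)"
    if "a < k" "k < e" "k \<notin> {a, b, c, d, e} \<union> {a, e}" for k
  proof -
    from that have "k \<notin> {a, b, c, d, e}" by auto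
    from gap_cases[OF that(1,2) this] show ?thesis
      using gaps[of k] by cases (simp_all add: ord_simps less_not_sym; blast)+
  qed
  then show ?thesis unfolding empty_polygon_def
    by (intro exI[of _ a] exI[of _ e]) (simp add: triples ord_simps)
qed

text \<open>Here \<open>b\<close> is the only inner vertex of the upper chain: the lower edge from
  \<open>a\<close> to \<open>c\<close> spans the first two gaps, the upper edge from
  \<open>b\<close> to \<open>e\<close> the last three.\<close>

lemma left_cap_pentagon:
  assumes "X a c d" "X c d e" "\<not> X a b e"
    and gaps: "\<And>k. a < k \<Longrightarrow> k < b \<Longrightarrow> X a k b \<longrightarrow> X a k c"
      "\<And>k. b < k \<Longrightarrow> k < c \<Longrightarrow> X b k e \<longrightarrow> X a k c"
      "\<And>k. c < k \<Longrightarrow> k < d \<Longrightarrow> X b k e \<longrightarrow> X c k d"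
      "\<And>k. d < k \<Longrightarrow> k < e \<Longrightarrow> X b k e \<longrightarrow> X d k e"
  shows "empty_polygon X {a, c, d, e} {a, b, e}"
proof -
  have triples: "X a c d" "X a c e" "X a d e" "X c d e" "\<not> X a b e"
    using assms(1-3) alt unfolding alternation_def by sat+
  have "(\<exists>u\<in>{a, c, d, e}. \<exists>v\<in>{a, c, d, e}. u < k \<and> k < v \<and> (\<forall>s\<in>{a, c, d, e}. s \<le> u \<or> v \<le> s) \<and> X u k v) \<or>
      (\<exists>u\<in>{a, b, e}. \<exists>v\<in>{a, b, e}. u < k \<and> k < v \<and> (\<forall>s\<in>{a, b, e}. s \<le> u \<or> v \<le> s) \<and> \<not> X u k v)"
    if "a < k" "k < e" "k \<notin> {a, c, d, e} \<union> {a, b, e}" for k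
  proof -
    from that have "k \<notin> {a, b, c, d, e}" by auto
    from gap_cases[OF that(1,2) this] show ?thesis
      using gaps[of k] by cases (simp_all add: ord_simps less_not_sym; blast)+
  qed
  then show ?thesis unfolding empty_polygon_def
    by (intro exI[of _ a] exI[of _ e]) (simp add: triples ord_simps)
qed

lemma middle_cap_pentagon:
  assumes "X a b d" "X b d e" "\<not> X a c e"
    and gaps: "\<And>k. a < k \<Longrightarrow> k < b \<Longrightarrow> X a k c \<longrightarrow> X a k b"
      "\<And>k. b < k \<Longrightarrow> k < c \<Longrightarrow> X a k c \<longrightarrow> X b k d"
      "\<And>k. c < k \<Longrightarrow> k < d \<Longrightarrow> X c k e \<longrightarrow> X b k d"
      "\<And>k. d < k \<Longrightarrow> k < e \<Longrightarrow> X c k e \<longrightarrow> X d k e"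
  shows "empty_polygon X {a, b, d, e} {a, c, e}"
proof -
  have triples: "X a b d" "X a b e" "X a d e" "X b d e" "\<not> X a c e"
    using assms(1-3) alt unfolding alternation_def by sat+
  have "(\<exists>u\<in>{a, b, d, e}. \<exists>v\<in>{a, b, d, e}. u < k \<and> k < v \<and> (\<forall>s\<in>{a, b, d, e}. s \<le> u \<or> v \<le> s) \<and> X u k v) \<or>
      (\<exists>u\<in>{a, c, e}. \<exists>v\<in>{a, c, e}. u < k \<and> k < v \<and> (\<forall>s\<in>{a, c, e}. s \<le> u \<or> v \<le> s) \<and> \<not> X u k v)"
    if "a < k" "k < e" "k \<notin> {a, b, d, e} \<union> {a, c, e}" for k
  proof -
    from that have "k \<notin> {a, b, c, d, e}" by auto
    from gap_cases[OF that(1,2) this] show ?thesis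
      using gaps[of k] by cases (simp_all add: ord_simps less_not_sym; blast)+
  qed
  then show ?thesis unfolding empty_polygon_def
    by (intro exI[of _ a] exI[of _ e]) (simp add: triples ord_simps)
qed

lemma right_cap_pentagon:
  assumes "X a b c" "X b c e" "\<not> X a d e"
    and gaps: "\<And>k. a < k \<Longrightarrow> k < b \<Longrightarrow> X a k d \<longrightarrow> X a k b"
      "\<And>k. b < k \<Longrightarrow> k < c \<Longrightarrow> X a k d \<longrightarrow> X b k c"
      "\<And>k. c < k \<Longrightarrow> k < d \<Longrightarrow> X a k d \<longrightarrow> X c k e"
      "\<And>k. d < k \<Longrightarrow> k < e \<Longrightarrow> X d k e \<longrightarrow> X c k e"
  shows "empty_polygon X {a, b, c, e} {a, d, e}"
proof -
  have triples: "X a b c" "X a b e" "X a c e" "X b c e" "\<not> X a d e"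
    using assms(1-3) alt unfolding alternation_def by sat+
  have "(\<exists>u\<in>{a, b, c, e}. \<exists>v\<in>{a, b, c, e}. u < k \<and> k < v \<and> (\<forall>s\<in>{a, b, c, e}. s \<le> u \<or> v \<le> s) \<and> X u k v) \<or>
      (\<exists>u\<in>{a, d, e}. \<exists>v\<in>{a, d, e}. u < k \<and> k < v \<and> (\<forall>s\<in>{a, d, e}. s \<le> u \<or> v \<le> s) \<and> \<not> X u k v)"
    if "a < k" "k < e" "k \<notin> {a, b, c, e} \<union> {a, d, e}" for k
  proof -
    from that have "k \<notin> {a, b, c, d, e}" by auto
    from gap_cases[OF that(1,2) this] show ?thesis
      using gaps[of k] by cases (simp_all add: ord_simps less_not_sym; blast)+
  qed
  then show ?thesis unfolding empty_polygon_def
    by (intro exI[of _ a] exI[of _ e]) (simp add: triples ord_simps)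
qed

text \<open>The only shape used with two inner vertices above; \<open>c\<close> is the single inner
  vertex below.\<close>

lemma two_caps_pentagon:
  assumes "X a c e" "\<not> X a b d" "\<not> X b d e"
    and gaps: "\<And>k. a < k \<Longrightarrow> k < b \<Longrightarrow> X a k b \<longrightarrow> X a k c"
      "\<And>k. b < k \<Longrightarrow> k < c \<Longrightarrow> X b k d \<longrightarrow> X a k c"
      "\<And>k. c < k \<Longrightarrow> k < d \<Longrightarrow> X b k d \<longrightarrow> X c k e"
      "\<And>k. d < k \<Longrightarrow> k < e \<Longrightarrow> X d k e \<longrightarrow> X c k e"
  shows "empty_polygon X {a, c, e} {a, b, d, e}"
proof -
  have triples: "X a c e" "\<not> X a b d" "\<not> X a b e" "\<not> X a d e" "\<not> X b d e"
    using assms(1-3) alt unfolding alternation_def by sat+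
  have "(\<exists>u\<in>{a, c, e}. \<exists>v\<in>{a, c, e}. u < k \<and> k < v \<and> (\<forall>s\<in>{a, c, e}. s \<le> u \<or> v \<le> s) \<and> X u k v) \<or>
      (\<exists>u\<in>{a, b, d, e}. \<exists>v\<in>{a, b, d, e}. u < k \<and> k < v \<and> (\<forall>s\<in>{a, b, d, e}. s \<le> u \<or> v \<le> s) \<and> \<not> X u k v)"
    if "a < k" "k < e" "k \<notin> {a, c, e} \<union> {a, b, d, e}" for k
  proof -
    from that have "k \<notin> {a, b, c, d, e}" by auto
    from gap_cases[OF that(1,2) this] show ?thesis
      using gaps[of k] by cases (simp_all add: ord_simps less_not_sym; blast)+
  qed
  then show ?thesis unfolding empty_polygon_def
    by (intro exI[of _ a] exI[of _ e]) (simp add: triples ord_simps)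
qed

end

section \<open>Reduction to finitely many orientations\<close>

definition quadruples :: "(nat \<Rightarrow> nat \<Rightarrow> nat \<Rightarrow> nat \<Rightarrow> bool) \<Rightarrow> bool" where
  "quadruples Q \<longleftrightarrow> list_all (\<lambda>a. list_all (\<lambda>b. list_all (\<lambda>c. list_all (Q a b c) [Suc c..<9]) [Suc b..<9])
     [Suc a..<9]) [0..<9]"

text \<open>Only pentagons with two radially consecutive vertices are of use, because such a pair
  later determines the apex. Lists in place of quantifiers let the conditions unfold into ground
  instances.\<close>

definition quintuples :: "(nat \<Rightarrow> nat \<Rightarrow> nat \<Rightarrow> nat \<Rightarrow> nat \<Rightarrow> bool) \<Rightarrow> bool" where
  "quintuples Q \<longleftrightarrow> quadruples (\<lambda>a b c d. list_all (\<lambda>e.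
     b = Suc a \<or> c = Suc b \<or> d = Suc c \<or> e = Suc d \<longrightarrow> Q a b c d e) [Suc d..<9])"

lemma quadruplesI:
  "(\<And>a b c d. a < b \<Longrightarrow> b < c \<Longrightarrow> c < d \<Longrightarrow> d < 9 \<Longrightarrow> Q a b c d) \<Longrightarrow> quadruples Q"
  by (simp add: quadruples_def list_all_iff)

lemma quintuplesI:
  "(\<And>a b c d e. a < b \<Longrightarrow> b < c \<Longrightarrow> c < d \<Longrightarrow> d < e \<Longrightarrow> e < 9 \<Longrightarrow>
     b = Suc a \<or> c = Suc b \<or> d = Suc c \<or> e = Suc d \<Longrightarrow> Q a b c d e) \<Longrightarrow> quintuples Q"
  unfolding quintuples_def by (rule quadruplesI) (simp add: list_all_iff)

text \<open>The last five assumptions exclude five of the eight shapes of an empty pentagon with two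
  consecutive vertices. Nine points suffice for a contradiction and eight do not, as was found
  by a SAT solver. The ground instances are propositional in the 84 orientations.\<close>

lemma nine_points_propositional:
  assumes "quadruples (alternation X)"
    and "quadruples (\<lambda>k i j l. X k i j \<or> X i j l \<or> list_ex (\<lambda>t. X i t j) [Suc i..<j])"
    and "quintuples (\<lambda>a b c d e. \<not> (X a b c \<and> X b c d \<and> X c d e \<and>
        list_all (\<lambda>k. X a k e \<longrightarrow> X a k b) [Suc a..<b] \<and> list_all (\<lambda>k. X a k e \<longrightarrow> X b k c) [Suc b..<c] \<and>
        list_all (\<lambda>k. X a k e \<longrightarrow> X c k d) [Suc c..<d] \<and> list_all (\<lambda>k. X a k e \<longrightarrow> X d k e) [Suc d..<e]))"
    and "quintuples (\<lambda>a b c d e. \<not> (X a c d \<and> X c d e \<and> \<not> X a b e \<and>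
        list_all (\<lambda>k. X a k b \<longrightarrow> X a k c) [Suc a..<b] \<and> list_all (\<lambda>k. X b k e \<longrightarrow> X a k c) [Suc b..<c] \<and>
        list_all (\<lambda>k. X b k e \<longrightarrow> X c k d) [Suc c..<d] \<and> list_all (\<lambda>k. X b k e \<longrightarrow> X d k e) [Suc d..<e]))"
    and "quintuples (\<lambda>a b c d e. \<not> (X a b d \<and> X b d e \<and> \<not> X a c e \<and>
        list_all (\<lambda>k. X a k c \<longrightarrow> X a k b) [Suc a..<b] \<and> list_all (\<lambda>k. X a k c \<longrightarrow> X b k d) [Suc b..<c] \<and>
        list_all (\<lambda>k. X c k e \<longrightarrow> X b k d) [Suc c..<d] \<and> list_all (\<lambda>k. X c k e \<longrightarrow> X d k e) [Suc d..<e]))"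
    and "quintuples (\<lambda>a b c d e. \<not> (X a b c \<and> X b c e \<and> \<not> X a d e \<and>
        list_all (\<lambda>k. X a k d \<longrightarrow> X a k b) [Suc a..<b] \<and> list_all (\<lambda>k. X a k d \<longrightarrow> X b k c) [Suc b..<c] \<and>
        list_all (\<lambda>k. X a k d \<longrightarrow> X c k e) [Suc c..<d] \<and> list_all (\<lambda>k. X d k e \<longrightarrow> X c k e) [Suc d..<e]))"
    and "quintuples (\<lambda>a b c d e. \<not> (X a c e \<and> \<not> X a b d \<and> \<not> X b d e \<and>
        list_all (\<lambda>k. X a k b \<longrightarrow> X a k c) [Suc a..<b] \<and> list_all (\<lambda>k. X b k d \<longrightarrow> X a k c) [Suc b..<c] \<and>
        list_all (\<lambda>k. X b k d \<longrightarrow> X c k e) [Suc c..<d] \<and> list_all (\<lambda>k. X d k e \<longrightarrow> X c k e) [Suc d..<e]))"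
  shows False
proof -
  note upt_conv_Cons [simp]
  show False
    using assms[unfolded quintuples_def quadruples_def alternation_def, simplified] by sat
qed

text \<open>Subtracting \<open>s\<close> moves the window to the indices below 9. Assumption
  \<open>free\<close> says that no empty triangle at the apex has points on the apex side of its
  opposite line on both flanks. Each of the five shapes, if present, would be a pentagon as
  required, so their absence meets the propositional contradiction.\<close>

lemma nine_points:
  assumes alt: "\<And>a b c d. a < b \<Longrightarrow> b < c \<Longrightarrow> c < d \<Longrightarrow> d < s + 9 \<Longrightarrow> alternation X a b c d"
    and free: "\<And>k i j l. s \<le> k \<Longrightarrow> k < i \<Longrightarrow> i < j \<Longrightarrow> j < l \<Longrightarrow> l < s + 9 \<Longrightarrow>
      X k i j \<or> X i j l \<or> (\<exists>t. i < t \<and> t < j \<and> X i t j)"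
  obtains D U i where "empty_polygon X D U" "D \<union> U \<subseteq> {s..<s + 9}" "card (D \<union> U) = 5"
    "i \<in> D \<union> U" "Suc i \<in> D \<union> U"
proof (rule ccontr)
  note found = that
  assume "\<not> thesis"
  then have none: False if "empty_polygon X D U" "D \<union> U = {s + a, s + b, s + c, s + d, s + e}"
    "a < b" "b < c" "c < d" "d < e" "e < 9" "b = Suc a \<or> c = Suc b \<or> d = Suc c \<or> e = Suc d" for D U a b c d e
  proof -
    have "D \<union> U \<subseteq> {s..<s + 9}" "card (D \<union> U) = 5" using that(3-7) unfolding that(2) by auto
    moreover have "\<exists>i. i \<in> D \<union> U \<and> Suc i \<in> D \<union> U" using that(8) unfolding that(2) by auto
    ultimately show False using found that(1) \<open>\<not> thesis\<close> by blast
  qed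
  have shift: "Q k" if "list_all (\<lambda>k. Q (s + k)) [Suc a..<b]" "s + a < k" "k < s + b" for Q a b k
    using that le_add_diff_inverse[of s k] by (auto simp: list_all_iff dest!: bspec[of _ _ "k - s"])
  let ?Y = "\<lambda>i j k. X (s + i) (s + j) (s + k)"
  have "quadruples (alternation ?Y)"
    using alt unfolding alternation_def by (intro quadruplesI) auto
  moreover have "quadruples (\<lambda>k i j l. ?Y k i j \<or> ?Y i j l \<or> list_ex (\<lambda>t. ?Y i t j) [Suc i..<j])"
  proof (rule quadruplesI)
    fix k i j l :: nat assume "k < i" "i < j" "j < l" "l < 9"
    then have "?Y k i j \<or> ?Y i j l \<or> (\<exists>t. s + i < t \<and> t < s + j \<and> X (s + i) t (s + j))" by (intro free) auto
    moreover have "list_ex (\<lambda>t. ?Y i t j) [Suc i..<j]" if "s + i < t" "t < s + j" "X (s + i) t (s + j)" for t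
      using that le_add_diff_inverse[of s t] by (auto simp: list_ex_iff intro!: bexI[of _ "t - s"])
    ultimately show "?Y k i j \<or> ?Y i j l \<or> list_ex (\<lambda>t. ?Y i t j) [Suc i..<j]" by auto
  qed
  moreover have "quintuples (\<lambda>a b c d e. \<not> (?Y a b c \<and> ?Y b c d \<and> ?Y c d e \<and>
        list_all (\<lambda>k. ?Y a k e \<longrightarrow> ?Y a k b) [Suc a..<b] \<and> list_all (\<lambda>k. ?Y a k e \<longrightarrow> ?Y b k c) [Suc b..<c] \<and>
        list_all (\<lambda>k. ?Y a k e \<longrightarrow> ?Y c k d) [Suc c..<d] \<and> list_all (\<lambda>k. ?Y a k e \<longrightarrow> ?Y d k e) [Suc d..<e]))"
  proof (intro quintuplesI notI, elim conjE)
    fix a b c d e :: nat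
    assume ord: "a < b" "b < c" "c < d" "d < e" "e < 9" and consecutive: "b = Suc a \<or> c = Suc b \<or> d = Suc c \<or> e = Suc d"
      and Y: "?Y a b c" "?Y b c d" "?Y c d e"
      and gaps: "list_all (\<lambda>k. ?Y a k e \<longrightarrow> ?Y a k b) [Suc a..<b]" "list_all (\<lambda>k. ?Y a k e \<longrightarrow> ?Y b k c) [Suc b..<c]"
        "list_all (\<lambda>k. ?Y a k e \<longrightarrow> ?Y c k d) [Suc c..<d]" "list_all (\<lambda>k. ?Y a k e \<longrightarrow> ?Y d k e) [Suc d..<e]"
    have "empty_polygon X {s + a, s + b, s + c, s + d, s + e} {s + a, s + e}"
      by (rule cup_pentagon[OF _ _ _ _ alt alt alt alt alt]) (use ord Y in \<open>auto dest: shift[OF gaps(1)] shift[OF gaps(2)] shift[OF gaps(3)] shift[OF gaps(4)]\<close>)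
    then show False by (rule none[OF _ _ ord consecutive]) auto
  qed
  moreover have "quintuples (\<lambda>a b c d e. \<not> (?Y a c d \<and> ?Y c d e \<and> \<not> ?Y a b e \<and>
        list_all (\<lambda>k. ?Y a k b \<longrightarrow> ?Y a k c) [Suc a..<b] \<and> list_all (\<lambda>k. ?Y b k e \<longrightarrow> ?Y a k c) [Suc b..<c] \<and>
        list_all (\<lambda>k. ?Y b k e \<longrightarrow> ?Y c k d) [Suc c..<d] \<and> list_all (\<lambda>k. ?Y b k e \<longrightarrow> ?Y d k e) [Suc d..<e]))"
  proof (intro quintuplesI notI, elim conjE)
    fix a b c d e :: nat
    assume ord: "a < b" "b < c" "c < d" "d < e" "e < 9" and consecutive: "b = Suc a \<or> c = Suc b \<or> d = Suc c \<or> e = Suc d"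
      and Y: "?Y a c d" "?Y c d e" "\<not> ?Y a b e"
      and gaps: "list_all (\<lambda>k. ?Y a k b \<longrightarrow> ?Y a k c) [Suc a..<b]" "list_all (\<lambda>k. ?Y b k e \<longrightarrow> ?Y a k c) [Suc b..<c]"
        "list_all (\<lambda>k. ?Y b k e \<longrightarrow> ?Y c k d) [Suc c..<d]" "list_all (\<lambda>k. ?Y b k e \<longrightarrow> ?Y d k e) [Suc d..<e]"
    have "empty_polygon X {s + a, s + c, s + d, s + e} {s + a, s + b, s + e}"
      by (rule left_cap_pentagon[OF _ _ _ _ alt alt alt alt alt]) (use ord Y in \<open>auto dest: shift[OF gaps(1)] shift[OF gaps(2)] shift[OF gaps(3)] shift[OF gaps(4)]\<close>)
    then show False by (rule none[OF _ _ ord consecutive]) auto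
  qed
  moreover have "quintuples (\<lambda>a b c d e. \<not> (?Y a b d \<and> ?Y b d e \<and> \<not> ?Y a c e \<and>
        list_all (\<lambda>k. ?Y a k c \<longrightarrow> ?Y a k b) [Suc a..<b] \<and> list_all (\<lambda>k. ?Y a k c \<longrightarrow> ?Y b k d) [Suc b..<c] \<and>
        list_all (\<lambda>k. ?Y c k e \<longrightarrow> ?Y b k d) [Suc c..<d] \<and> list_all (\<lambda>k. ?Y c k e \<longrightarrow> ?Y d k e) [Suc d..<e]))"
  proof (intro quintuplesI notI, elim conjE)
    fix a b c d e :: nat
    assume ord: "a < b" "b < c" "c < d" "d < e" "e < 9" and consecutive: "b = Suc a \<or> c = Suc b \<or> d = Suc c \<or> e = Suc d"
      and Y: "?Y a b d" "?Y b d e" "\<not> ?Y a c e"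
      and gaps: "list_all (\<lambda>k. ?Y a k c \<longrightarrow> ?Y a k b) [Suc a..<b]" "list_all (\<lambda>k. ?Y a k c \<longrightarrow> ?Y b k d) [Suc b..<c]"
        "list_all (\<lambda>k. ?Y c k e \<longrightarrow> ?Y b k d) [Suc c..<d]" "list_all (\<lambda>k. ?Y c k e \<longrightarrow> ?Y d k e) [Suc d..<e]"
    have "empty_polygon X {s + a, s + b, s + d, s + e} {s + a, s + c, s + e}"
      by (rule middle_cap_pentagon[OF _ _ _ _ alt alt alt alt alt]) (use ord Y in \<open>auto dest: shift[OF gaps(1)] shift[OF gaps(2)] shift[OF gaps(3)] shift[OF gaps(4)]\<close>)
    then show False by (rule none[OF _ _ ord consecutive]) auto
  qed
  moreover have "quintuples (\<lambda>a b c d e. \<not> (?Y a b c \<and> ?Y b c e \<and> \<not> ?Y a d e \<and>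
        list_all (\<lambda>k. ?Y a k d \<longrightarrow> ?Y a k b) [Suc a..<b] \<and> list_all (\<lambda>k. ?Y a k d \<longrightarrow> ?Y b k c) [Suc b..<c] \<and>
        list_all (\<lambda>k. ?Y a k d \<longrightarrow> ?Y c k e) [Suc c..<d] \<and> list_all (\<lambda>k. ?Y d k e \<longrightarrow> ?Y c k e) [Suc d..<e]))"
  proof (intro quintuplesI notI, elim conjE)
    fix a b c d e :: nat
    assume ord: "a < b" "b < c" "c < d" "d < e" "e < 9" and consecutive: "b = Suc a \<or> c = Suc b \<or> d = Suc c \<or> e = Suc d"
      and Y: "?Y a b c" "?Y b c e" "\<not> ?Y a d e"
      and gaps: "list_all (\<lambda>k. ?Y a k d \<longrightarrow> ?Y a k b) [Suc a..<b]" "list_all (\<lambda>k. ?Y a k d \<longrightarrow> ?Y b k c) [Suc b..<c]"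
        "list_all (\<lambda>k. ?Y a k d \<longrightarrow> ?Y c k e) [Suc c..<d]" "list_all (\<lambda>k. ?Y d k e \<longrightarrow> ?Y c k e) [Suc d..<e]"
    have "empty_polygon X {s + a, s + b, s + c, s + e} {s + a, s + d, s + e}"
      by (rule right_cap_pentagon[OF _ _ _ _ alt alt alt alt alt]) (use ord Y in \<open>auto dest: shift[OF gaps(1)] shift[OF gaps(2)] shift[OF gaps(3)] shift[OF gaps(4)]\<close>)
    then show False by (rule none[OF _ _ ord consecutive]) auto
  qed
  moreover have "quintuples (\<lambda>a b c d e. \<not> (?Y a c e \<and> \<not> ?Y a b d \<and> \<not> ?Y b d e \<and>
        list_all (\<lambda>k. ?Y a k b \<longrightarrow> ?Y a k c) [Suc a..<b] \<and> list_all (\<lambda>k. ?Y b k d \<longrightarrow> ?Y a k c) [Suc b..<c] \<and>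
        list_all (\<lambda>k. ?Y b k d \<longrightarrow> ?Y c k e) [Suc c..<d] \<and> list_all (\<lambda>k. ?Y d k e \<longrightarrow> ?Y c k e) [Suc d..<e]))"
  proof (intro quintuplesI notI, elim conjE)
    fix a b c d e :: nat
    assume ord: "a < b" "b < c" "c < d" "d < e" "e < 9" and consecutive: "b = Suc a \<or> c = Suc b \<or> d = Suc c \<or> e = Suc d"
      and Y: "?Y a c e" "\<not> ?Y a b d" "\<not> ?Y b d e"
      and gaps: "list_all (\<lambda>k. ?Y a k b \<longrightarrow> ?Y a k c) [Suc a..<b]" "list_all (\<lambda>k. ?Y b k d \<longrightarrow> ?Y a k c) [Suc b..<c]"
        "list_all (\<lambda>k. ?Y b k d \<longrightarrow> ?Y c k e) [Suc c..<d]" "list_all (\<lambda>k. ?Y d k e \<longrightarrow> ?Y c k e) [Suc d..<e]"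
    have "empty_polygon X {s + a, s + c, s + e} {s + a, s + b, s + d, s + e}"
      by (rule two_caps_pentagon[OF _ _ _ _ alt alt alt alt alt]) (use ord Y in \<open>auto dest: shift[OF gaps(1)] shift[OF gaps(2)] shift[OF gaps(3)] shift[OF gaps(4)]\<close>)
    then show False by (rule none[OF _ _ ord consecutive]) auto
  qed
  ultimately show False by (rule nine_points_propositional)
qed

section \<open>Counting over apices and windows\<close>

text \<open>A line strictly separating \<open>p\<close> from the hull of the other points provides a
  direction \<open>n\<close> from which angles at \<open>p\<close> are measured; sorting by the
  tangent of the angle gives the radial order.\<close>

lemma exists_fan:
  assumes "finite P" "general_position P" "p \<in> first_layer P"
  obtains q where "fan P p q (card P - 1)"
proof -
  define Q where "Q = P - {p}"
  have p: "p \<in> P" "p \<notin> convex hull Q"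
    using assms first_layer_not_in_hull by (auto simp: first_layer_def Q_def)
  have "finite Q" using assms by (simp add: Q_def)
  obtain n b where nb: "n \<bullet> p < b" "\<And>x. x \<in> convex hull Q \<Longrightarrow> b < n \<bullet> x"
    using separating_hyperplane_closed_point[of "convex hull Q" p] p(2) \<open>finite Q\<close>
    by (metis closed_Int_compact compact_imp_closed finite_imp_compact_convex_hull convex_convex_hull)
  then have f: "n \<bullet> (x - p) > 0" if "x \<in> Q" for x
    using hull_inc[OF that, of convex] by (force simp: inner_diff_right)
  \<comment> \<open>The tangent of the clockwise angle from \<open>n\<close> to
    \<open>x - p\<close>. After clearing the positive denominators, a difference of two keys becomes
    \<open>orient p x y\<close> times \<open>n \<bullet> n\<close>, up to sign.\<close>
  define key where "key x = (n $ 2 * (x $ 1 - p $ 1) - n $ 1 * (x $ 2 - p $ 2)) / (n \<bullet> (x - p))" for x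
  have key: "key x < key y \<longleftrightarrow> orient p x y < 0" if "x \<in> Q" "y \<in> Q" for x y
  proof -
    have "n \<noteq> 0" using f[OF that(1)] by auto
    then have "n \<bullet> n > 0" by simp
    have "key x < key y \<longleftrightarrow> (n $ 2 * (x $ 1 - p $ 1) - n $ 1 * (x $ 2 - p $ 2)) * (n \<bullet> (y - p))
        < (n $ 2 * (y $ 1 - p $ 1) - n $ 1 * (y $ 2 - p $ 2)) * (n \<bullet> (x - p))"
      unfolding key_def using f[OF that(1)] f[OF that(2)] by (simp add: divide_simps mult.commute)
    also have "\<dots> \<longleftrightarrow> 0 < - (n \<bullet> n) * orient p x y"
      unfolding orient_def inner_vec_def by (simp add: sum_2 algebra_simps)
    also have "\<dots> \<longleftrightarrow> orient p x y < 0"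
      using mult_less_cancel_left_pos[OF \<open>n \<bullet> n > 0\<close>, of "orient p x y" 0] by simp
    finally show ?thesis .
  qed
  have "inj_on key Q"
  proof (rule inj_onI, rule ccontr)
    fix x y assume xy: "x \<in> Q" "y \<in> Q" "key x = key y" "x \<noteq> y"
    then have "orient p x y \<noteq> 0"
      using p by (intro general_positionD[OF assms(2)]) (auto simp: Q_def)
    then show False using key[of x y] key[of y x] xy orient_neg_perms[of p x y] orient_swap'[of p x y] by auto
  qed
  define ks where "ks = sorted_list_of_set (key ` Q)"
  define q where "q i = inv_into Q key (ks ! i)" for i
  have len: "length ks = card P - 1"
    using \<open>inj_on key Q\<close> p(1) assms(1) by (simp add: ks_def card_image Q_def)
  have ks: "set ks = key ` Q" "distinct ks" "sorted_wrt (<) ks"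
    using \<open>finite Q\<close> by (simp_all add: ks_def)
  have qQ: "q i \<in> Q" "key (q i) = ks ! i" if "i < card P - 1" for i
  proof -
    have "ks ! i \<in> key ` Q" using that len ks(1) by (metis nth_mem)
    then show "q i \<in> Q" "key (q i) = ks ! i" by (simp_all add: q_def inv_into_into f_inv_into_f)
  qed
  have "bij_betw (\<lambda>i. ks ! i) {..<card P - 1} (key ` Q)"
    using bij_betw_nth[of ks "{..<card P - 1}"] ks len by auto
  moreover have "bij_betw (inv_into Q key) (key ` Q) Q"
    using \<open>inj_on key Q\<close> by (simp add: bij_betw_inv_into inj_on_imp_bij_betw)
  ultimately have "bij_betw q {..<card P - 1} Q"
    unfolding q_def by (rule bij_betw_trans[unfolded comp_def])
  moreover have "orient p (q i) (q j) < 0" if "i < j" "j < card P - 1" for i j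
    using that qQ[of i] qQ[of j] key[of "q i" "q j"] ks(3) len by (auto simp: sorted_wrt_iff_nth_less)
  ultimately have "fan P p q (card P - 1)"
    using p assms(2) by unfold_locales (auto simp: Q_def)
  then show ?thesis by (rule that)
qed

section \<open>Recovering the apex from two vertices of a hole\<close>

text \<open>Among the points on its own side of the line \<open>a b\<close>, \<open>p\<close> is radially the first as seen from \<open>a\<close>
  (the last as seen from \<open>b\<close>). So an ordered pair \<open>(a, b)\<close> is of this kind for at most one \<open>p\<close>.\<close>

definition first_beyond :: "(real ^ 2) set \<Rightarrow> real ^ 2 \<Rightarrow> real ^ 2 \<Rightarrow> real ^ 2 \<Rightarrow> bool" where
  "first_beyond P p a b \<longleftrightarrow> p \<in> P \<and> orient p a b < 0 \<and> (\<forall>s\<in>P. s \<noteq> p \<longrightarrow> orient s a b < 0 \<longrightarrow> orient p a s < 0)"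

definition last_beyond :: "(real ^ 2) set \<Rightarrow> real ^ 2 \<Rightarrow> real ^ 2 \<Rightarrow> real ^ 2 \<Rightarrow> bool" where
  "last_beyond P p a b \<longleftrightarrow> p \<in> P \<and> orient p a b < 0 \<and> (\<forall>s\<in>P. s \<noteq> p \<longrightarrow> orient s a b < 0 \<longrightarrow> orient p s b < 0)"

text \<open>Two different candidates would make both \<open>orient p a p'\<close> and
  \<open>orient p' a p\<close> negative, but these are opposite.\<close>

lemma first_beyond_unique: "first_beyond P p a b \<Longrightarrow> first_beyond P p' a b \<Longrightarrow> p = p'"
  unfolding first_beyond_def by (metis orient_neg_perms less_asym)

lemma last_beyond_unique: "last_beyond P p a b \<Longrightarrow> last_beyond P p' a b \<Longrightarrow> p = p'"
  unfolding last_beyond_def by (metis orient_neg_perms less_asym)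

text \<open>Without a hole at \<open>p\<close> that meets the window, the assumptions of
  \<open>nine_points\<close> hold, and the two consecutive vertices it provides span an empty
  triangle with \<open>p\<close>. One flank of that triangle then has no point on the side of
  \<open>p\<close>.\<close>

lemma (in fan) window_hole:
  assumes "s + 9 \<le> m"
  obtains S where "hole P S" "p \<in> S" "\<exists>i\<in>{s..<s + 9}. q i \<in> S"
  | S i where "hole P S" "i \<in> {s..<s + 9}" "Suc i \<in> {s..<s + 9}" "q i \<in> S" "q (Suc i) \<in> S"
      "first_beyond P p (q i) (q (Suc i)) \<or> last_beyond P p (q i) (q (Suc i))"
proof (cases "\<exists>S. hole P S \<and> p \<in> S \<and> (\<exists>i\<in>{s..<s + 9}. q i \<in> S)")
  case True
  then show ?thesis using that(1) by blast
next
  case False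
  \<comment> \<open>Only \<open>i\<close> and \<open>j\<close> are confined to the window. The
    flanking \<open>k\<close> and \<open>l\<close> range over all indices, as the conclusions about
    first and last points concern all of \<open>P\<close>.\<close>
  have free: "cup k i j \<or> cup i j l \<or> (\<exists>t. i < t \<and> t < j \<and> cup i t j)"
    if "k < i" "i < j" "j < l" "l < m" "s \<le> i" "j < s + 9" for k i j l
  proof (rule ccontr)
    assume "\<not> ?thesis"
    then have "\<exists>S. hole P S \<and> p \<in> S \<and> q i \<in> S"
      using that by (intro empty_pentagon_at_apex[of i j k l]) auto
    then show False using False that by auto
  qed
  obtain D U i where DU: "empty_polygon cup D U" "D \<union> U \<subseteq> {s..<s + 9}" "card (D \<union> U) = 5"
      "i \<in> D \<union> U" "Suc i \<in> D \<union> U"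
  proof (rule nine_points[of s cup])
    show "alternation cup a b c d" if "a < b" "b < c" "c < d" "d < s + 9" for a b c d
      using that assms by (intro alternation_cup) auto
    show "cup k i j \<or> cup i j l \<or> (\<exists>t. i < t \<and> t < j \<and> cup i t j)"
      if "s \<le> k" "k < i" "i < j" "j < l" "l < s + 9" for k i j l
      using that assms by (intro free) auto
  qed
  have i: "Suc i < m" "s \<le> i" "Suc i < s + 9" using DU assms by auto
  then have "orient p (q i) (q (Suc i)) < 0" by (intro sorted) auto
  have "first_beyond P p (q i) (q (Suc i)) \<or> last_beyond P p (q i) (q (Suc i))"
  \<comment> \<open>If every earlier point is above the line through \<open>q i\<close> and
    \<open>q (Suc i)\<close>, then \<open>p\<close> is first beyond it. Otherwise
    \<open>free\<close>, with no index between \<open>i\<close> and \<open>Suc i\<close>, puts every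
    later point above the line, and \<open>p\<close> is last.\<close>
  proof (cases "\<forall>k<i. cup k i (Suc i)")
    case True
    have "orient p (q i) x < 0" if "x \<in> P" "x \<noteq> p" "orient x (q i) (q (Suc i)) < 0" for x
      using that(1)
    proof (cases rule: point_cases)
      case (2 k)
      have "\<not> k < i" using True that(3) 2 by (auto simp: cup_def)
      moreover have "k \<noteq> i" using that(3) 2 by auto
      ultimately show ?thesis using 2 by (auto intro: sorted)
    qed (use that in auto)
    then show ?thesis using p_in \<open>orient p (q i) (q (Suc i)) < 0\<close> by (auto simp: first_beyond_def)
  next
    case False
    then obtain k where k: "k < i" "\<not> cup k i (Suc i)" by auto
    have right: "cup i (Suc i) l" if "Suc i < l" "l < m" for l
      using free[of k i "Suc i" l] k that i by auto
    have "orient p x (q (Suc i)) < 0" if "x \<in> P" "x \<noteq> p" "orient x (q i) (q (Suc i)) < 0" for x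
      using that(1)
    proof (cases rule: point_cases)
      case (2 l)
      have "\<not> Suc i < l" using right[of l] that(3) 2 orient_neg_perms[of x "q i" "q (Suc i)"] by (auto simp: cup_def)
      moreover have "l \<noteq> Suc i" using that(3) 2 by auto
      ultimately show ?thesis using 2 i by (auto intro: sorted)
    qed (use that in auto)
    then show ?thesis using p_in \<open>orient p (q i) (q (Suc i)) < 0\<close> by (auto simp: last_beyond_def)
  qed
  then show ?thesis
    using that(2)[of "q ` (D \<union> U)" i] hole_if_empty_polygon[OF DU(1) _ DU(3)] DU i assms by force
qed

section \<open>Injective encoding of apices and windows by holes\<close>

text \<open>A hole \<open>S\<close> found in the window \<open>w\<close> at \<open>p\<close> determines \<open>(p, w)\<close> up to the choice of two of its
  vertices and of one of three cases, whence the factor \<open>5 * 5 * 3\<close>.\<close>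

lemma card_holes_ge:
  assumes "finite P" "general_position P"
  shows "card (first_layer P) * ((card P - 1) div 9) \<le> 75 * card {S. hole P S}"
proof -
  define N where "N = (card P - 1) div 9"
  define H where "H = {S. hole P S}"
  have fin: "finite H" "\<And>S. S \<in> H \<Longrightarrow> card S = 5"
    using assms(1) finite_subset[of H "Pow P"] by (auto simp: H_def hole_def)
  have "\<forall>p\<in>first_layer P. \<exists>q. fan P p q (card P - 1)"
    using exists_fan[OF assms] by blast
  then obtain q where q: "\<And>p. p \<in> first_layer P \<Longrightarrow> fan P p (q p) (card P - 1)" by metis
  define W where "W p w = q p ` {9 * w..<9 * w + 9}" for p w
  have W_disjoint: "w = w'" if "p \<in> first_layer P" "w < N" "w' < N" "x \<in> W p w" "x \<in> W p w'" for p w w' x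
  proof -
    from that obtain i j where ij: "i \<in> {9 * w..<9 * w + 9}" "j \<in> {9 * w'..<9 * w' + 9}" "q p i = q p j"
      by (auto simp: W_def)
    have "9 * w + 9 \<le> card P - 1" "9 * w' + 9 \<le> card P - 1" using that(2,3) by (auto simp: N_def)
    then have "i = j" using ij fan.q_eq_iff[OF q[OF that(1)], of i j] by auto
    then show ?thesis using ij by auto
  qed
  \<comment> \<open>The tag \<open>t\<close> tells how to recover \<open>p\<close>: it is
    \<open>a\<close> itself, or the unique point first or last beyond \<open>a\<close> and
    \<open>b\<close>. In each case one of \<open>a\<close>, \<open>b\<close> lies in the window and
    identifies \<open>w\<close>.\<close>
  define code where "code p w S a b t \<longleftrightarrow> S \<in> H \<and> a \<in> S \<and> b \<in> S \<and>
      (t = 0 \<and> a = p \<and> b \<in> W p w \<or> t = 1 \<and> a \<in> W p w \<and> first_beyond P p a b \<or>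
       t = 2 \<and> a \<in> W p w \<and> last_beyond P p a b)" for p w S a b and t :: nat
  have "\<exists>c. (\<lambda>(S, a, b, t). code p w S a b t) c" if "p \<in> first_layer P" "w < N" for p w
  proof -
    interpret fan P p "q p" "card P - 1" by (rule q) fact
    have "9 * w + 9 \<le> card P - 1" using that(2) by (auto simp: N_def)
    then have "\<exists>S a b t. code p w S a b t"
    proof (cases rule: window_hole)
      case (1 S)
      then obtain i where "i \<in> {9 * w..<9 * w + 9}" "q p i \<in> S" by blast
      then have "code p w S p (q p i) 0" using 1 by (auto simp: code_def H_def W_def)
      then show ?thesis by blast
    next
      case (2 S i)
      then have "code p w S (q p i) (q p (Suc i)) 1 \<or> code p w S (q p i) (q p (Suc i)) 2"
        by (auto simp: code_def H_def W_def)
      then show ?thesis by blast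
    qed
    then show ?thesis by auto
  qed
  then obtain g where g: "\<And>p w. p \<in> first_layer P \<Longrightarrow> w < N \<Longrightarrow> (\<lambda>(S, a, b, t). code p w S a b t) (g p w)"
    by metis
  have "inj_on (\<lambda>(p, w). g p w) (first_layer P \<times> {..<N})"
  proof (rule inj_onI)
    fix x y assume xy: "x \<in> first_layer P \<times> {..<N}" "y \<in> first_layer P \<times> {..<N}"
      "(\<lambda>(p, w). g p w) x = (\<lambda>(p, w). g p w) y"
    obtain p w p' w' where eq: "x = (p, w)" "y = (p', w')" by (metis surj_pair)
    then have pw: "p \<in> first_layer P" "w < N" "p' \<in> first_layer P" "w' < N" "g p w = g p' w'"
      using xy by auto
    obtain S a b t where "g p w = (S, a, b, t)" by (metis prod_cases4)
    then have c: "code p w S a b t" "code p' w' S a b t" using g[of p w] g[of p' w'] pw by auto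
    then have "p = p'"
      unfolding code_def using first_beyond_unique last_beyond_unique by (elim conjE disjE) auto
    \<comment> \<open>\<open>z\<close> is \<open>b\<close> for tag 0 and \<open>a\<close> for the
      other tags; windows at one apex are disjoint.\<close>
    moreover obtain z where "z \<in> W p w" "z \<in> W p' w'" using c unfolding code_def by (elim conjE disjE) auto
    ultimately show "x = y" using W_disjoint[of p w w' z] pw eq by auto
  qed
  then have "card (first_layer P \<times> {..<N}) \<le> card (SIGMA S:H. S \<times> S \<times> {..<3::nat})"
  proof (rule card_inj_on_le)
    show "(\<lambda>(p, w). g p w) ` (first_layer P \<times> {..<N}) \<subseteq> (SIGMA S:H. S \<times> S \<times> {..<3})"
      using g by (fastforce simp: code_def)
    have "finite S" if "S \<in> H" for S using fin(2)[OF that] by (metis card.infinite zero_neq_numeral)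
    then show "finite (SIGMA S:H. S \<times> S \<times> {..<3::nat})" using fin by auto
  qed
  also have "\<dots> = (\<Sum>S\<in>H. 75)"
    using fin by (subst card_SigmaI) (auto simp: card_cartesian_product finite_subset intro: card_ge_0_finite)
  finally show ?thesis by (simp add: N_def H_def card_cartesian_product)
qed

text \<open>From 18 points on, \<open>(card P - 1) div 9\<close> is at least
  \<open>card P / 18\<close>, and \<open>1350 = 18 * 75\<close>. For fewer points the bound is
  negative.\<close>

lemma card_five_holes_ge:
  assumes "finite P" "general_position P"
  shows "real (card (five_holes P)) \<ge> real (card (first_layer P)) * real (card P) / 1350 - 1350"
proof (cases "card P < 18")
  case True
  have "card (first_layer P) \<le> card P"
    using assms(1) by (auto simp: first_layer_def intro: card_mono)
  then have "real (card (first_layer P)) * real (card P) \<le> 18 * 18"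
    using True by (intro mult_mono) auto
  then show ?thesis by simp
next
  case False
  have "real (card P) \<le> 18 * real ((card P - 1) div 9)"
  proof -
    have "card P \<le> 18 * ((card P - 1) div 9)" using False by presburger
    then show ?thesis by linarith
  qed
  then have "real (card (first_layer P)) * real (card P)
      \<le> real (card (first_layer P)) * (18 * real ((card P - 1) div 9))"
    by (rule mult_left_mono) simp
  also have "\<dots> \<le> 18 * (75 * real (card {S. hole P S}))"
    using card_holes_ge[OF assms] by (simp flip: of_nat_mult)
  also have "\<dots> \<le> 18 * (75 * real (card (five_holes P)))"
    using card_holes_le[OF assms(1)] by simp
  finally show ?thesis by simp
qed

section \<open>Layers\<close>

definition peel :: "(real ^ 2) set \<Rightarrow> nat \<Rightarrow> (real ^ 2) set" where
  "peel P k = P - (\<Union>j\<in>{1..k}. layer P j)"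

lemma layer_Suc: "layer P (Suc k) = first_layer (peel P k)"
  by (subst layer.simps) (simp add: peel_def atLeastLessThanSuc_atLeastAtMost)

lemma peel_0 [simp]: "peel P 0 = P"
  by (simp add: peel_def)

lemma peel_Suc: "peel P (Suc k) = peel P k - first_layer (peel P k)"
  using layer_Suc[of P k] by (auto simp: peel_def atLeastAtMostSuc_conv)

lemma peel_subset: "peel P k \<subseteq> P"
  by (auto simp: peel_def)

lemma first_layer_subset: "first_layer P \<subseteq> P"
  by (auto simp: first_layer_def)

text \<open>The hull has an extreme point; it belongs to \<open>P\<close> and is not
  interior.\<close>

lemma first_layer_nonempty:
  assumes "finite P" "P \<noteq> {}" shows "first_layer P \<noteq> {}"
proof -
  obtain x where x: "x extreme_point_of (convex hull P)"
    using extreme_point_exists_convex[of "convex hull P"] assms by (auto simp: finite_imp_compact compact_convex_hull)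
  then have "x \<in> P" using extreme_point_of_convex_hull by auto
  moreover have "x \<notin> interior (convex hull P)" using x by (rule extreme_point_not_in_interior)
  ultimately show ?thesis
    using hull_inc[of x P convex] closure_subset[of "convex hull P"] by (auto simp: first_layer_def frontier_def)
qed

text \<open>Each nonempty remainder loses at least one point, so \<open>card P\<close> layers
  exhaust \<open>P\<close>. Hence the \<open>LEAST\<close> in \<open>num_layers\<close> is
  attained.\<close>

lemma peel_num_layers:
  assumes "finite P" shows "peel P (num_layers P) = {}"
proof -
  have "card (peel P k) \<le> card P - k" for k
  proof (induction k)
    case (Suc k)
    have "finite (peel P k)" using assms peel_subset finite_subset by blast
    then have "card (peel P (Suc k)) = card (peel P k) - card (first_layer (peel P k))"
      unfolding peel_Suc by (intro card_Diff_subset first_layer_subset finite_subset[OF first_layer_subset])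
    moreover have "peel P k = {} \<or> card (first_layer (peel P k)) > 0"
      using first_layer_nonempty[OF \<open>finite (peel P k)\<close>] \<open>finite (peel P k)\<close>
      by (auto simp: card_gt_0_iff intro: finite_subset[OF first_layer_subset])
    ultimately show ?case using Suc by auto
  qed simp
  from this[of "card P"] have "peel P (card P) = {}"
    using assms finite_subset[OF peel_subset] by (metis card_0_eq diff_self_eq_0 le_zero_eq)
  moreover have "(\<Union>j\<in>{1..k}. layer P j) \<subseteq> P" for k
  proof -
    have "layer P j \<subseteq> P" if "j \<ge> 1" for j
      using that layer_Suc[of P "j - 1"] first_layer_subset peel_subset by fastforce
    then show ?thesis by (intro UN_least) simp
  qed
  ultimately have "P = (\<Union>j\<in>{1..card P}. layer P j)" by (auto simp: peel_def)
  then have "P = (\<Union>j\<in>{1..num_layers P}. layer P j)"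
    unfolding num_layers_def by (rule LeastI)
  then show ?thesis by (auto simp: peel_def)
qed

text \<open>The removed points lie on the frontier of the hull of \<open>P\<close>, while the
  interior of \<open>H\<close> is contained in the interior of that hull, so none of them can spoil
  the hole.\<close>

lemma five_holes_peel_Suc: "five_holes (P - first_layer P) \<subseteq> five_holes P"
proof
  fix H assume H: "H \<in> five_holes (P - first_layer P)"
  then have "H = convex hull (vertices H)"
    unfolding vertices_def five_holes_def convex_pentagon_def
    by (auto intro!: Krein_Milman_Minkowski polytope_imp_compact polytope_imp_convex)
  moreover have "vertices H \<subseteq> P" using H by (auto simp: five_holes_def)
  ultimately have "H \<subseteq> convex hull P" by (metis hull_mono)
  then have "interior H \<subseteq> interior (convex hull P)" by (rule interior_mono)
  then show "H \<in> five_holes P" using H by (auto simp: five_holes_def first_layer_def frontier_def)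
qed

lemma five_holes_peel: "five_holes (peel P k) \<subseteq> five_holes P"
  by (induction k) (use five_holes_peel_Suc in \<open>auto simp: peel_Suc\<close>)

lemma exists_large_layer:
  assumes "finite P" "num_layers P > 0"
  shows "\<exists>k. real (card (first_layer (peel P k))) * real (card (peel P k))
           \<ge> (real (card P))\<^sup>2 / (2 * real (num_layers P))"
proof (rule ccontr)
  let ?L = "num_layers P" and ?r = "\<lambda>k. real (card (peel P k))"
  assume "\<not> ?thesis"
  then have small: "real (card (first_layer (peel P k))) * ?r k < (real (card P))\<^sup>2 / (2 * real ?L)" for k
    by (simp add: not_le)
  \<comment> \<open>With \<open>l\<close> points removed from \<open>r\<close>, the difference of
    squares is \<open>2 * l * r\<close> minus the square of \<open>l\<close>. The sum over all
    layers telescopes to the square of \<open>card P\<close>.\<close>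
  have step: "(?r k)\<^sup>2 - (?r (Suc k))\<^sup>2 \<le> 2 * (real (card (first_layer (peel P k))) * ?r k)" for k
  proof -
    have fin: "finite (peel P k)" using assms peel_subset finite_subset by blast
    define l where "l = real (card (first_layer (peel P k)))"
    have "?r (Suc k) = ?r k - l"
      unfolding peel_Suc l_def using fin first_layer_subset[of "peel P k"]
      by (simp add: card_Diff_subset finite_subset of_nat_diff card_mono)
    then have "(?r k)\<^sup>2 - (?r (Suc k))\<^sup>2 = 2 * (l * ?r k) - l\<^sup>2"
      by (simp only: power2_eq_square) (simp add: algebra_simps)
    then show ?thesis unfolding l_def[symmetric] by simp
  qed
  have "(real (card P))\<^sup>2 = (\<Sum>k<?L. (?r k)\<^sup>2 - (?r (Suc k))\<^sup>2)"
    using peel_num_layers[OF assms(1)] sum_lessThan_telescope'[of "\<lambda>k. (?r k)\<^sup>2" ?L] by simp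
  also have "\<dots> \<le> (\<Sum>k<?L. 2 * (real (card (first_layer (peel P k))) * ?r k))"
    by (intro sum_mono step)
  also have "\<dots> < (\<Sum>k<?L. (real (card P))\<^sup>2 / real ?L)"
    using small assms(2) by (intro sum_strict_mono) (auto simp: field_simps)
  also have "\<dots> = (real (card P))\<^sup>2" using assms(2) by simp
  finally show False by simp
qed

theorem theorem2p1:
  "\<exists>c::real. c > 0 \<and>
     (\<forall>P :: (real ^ 2) set. finite P \<longrightarrow> general_position P \<longrightarrow>
        real (card (five_holes P)) \<ge> c * ((real (card P))\<^sup>2 / real (num_layers P)) - inverse c \<and>
        real (card (five_holes P)) \<ge> c * real (card (layer P 1)) * real (card P) - inverse c)"
\<comment> \<open>\<open>2700 = 2 * 1350\<close>, the factor 2 coming from the averaging over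
  layers.\<close>
proof (intro exI[of _ "1 / 2700"] conjI allI impI)
  fix P :: "(real ^ 2) set"
  assume P: "finite P" "general_position P"
  have "real (card (first_layer P)) * real (card P) \<ge> 0" by simp
  then show "real (card (five_holes P)) \<ge> 1 / 2700 * real (card (layer P 1)) * real (card P) - inverse (1 / 2700)"
    using card_five_holes_ge[OF P] layer_Suc[of P 0] by simp
  show "real (card (five_holes P)) \<ge> 1 / 2700 * ((real (card P))\<^sup>2 / real (num_layers P)) - inverse (1 / 2700)"
  \<comment> \<open>For zero layers the quotient is 0 by the convention on division, and the bound
    is negative.\<close>
  proof (cases "num_layers P = 0")
    case False
    then obtain k where k: "real (card (first_layer (peel P k))) * real (card (peel P k))
           \<ge> (real (card P))\<^sup>2 / (2 * real (num_layers P))"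
      using exists_large_layer[OF P(1)] by auto
    have "finite (peel P k)" "general_position (peel P k)"
      using P peel_subset[of P k] by (auto simp: general_position_def intro: finite_subset)
    then have "real (card (five_holes (peel P k))) \<ge>
        real (card (first_layer (peel P k))) * real (card (peel P k)) / 1350 - 1350"
      by (rule card_five_holes_ge)
    moreover have "card (five_holes (peel P k)) \<le> card (five_holes P)"
      using five_holes_peel finite_five_holes[OF P(1)] by (intro card_mono)
    ultimately show ?thesis using k by simp
  qed simp
qed simp

end
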